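(* Let $S_n\ne 0$ be the sample covariance matrix of a sample in $\mathbb{R}^q$, and let $\eta\ge 0$, with $\eta>0$ if $S_n$ is singular. Let $\Pi_{R,s}(\Sigma)=\|\log\Sigma-q^{-1}\{\log\det\Sigma\}I_q\|_F^2$ for $\Sigma>0$. Then the function $$L(\Sigma;S_n,\eta)=\mathrm{tr}(\Sigma^{-1}S_n)+\log\det\Sigma+\eta\,\Pi_{R,s}(\Sigma),\qquad \Sigma>0,$$ is strictly g-convex and g-coercive; consequently it has a unique critical point, and this critical point is its unique global minimizer over $\Sigma>0$.
   Context: $\Sigma>0$ means $\Sigma$ is a real symmetric positive definite matrix of order $q$; $\|\cdot\|_F$ is the Frobenius norm and $\log\Sigma$ the matrix logarithm. For a sample $x_1,\ldots,x_n\in\mathbb{R}^q$, the sample covariance matrix is $S_n=n^{-1}\sum_{i=1}^n(x_i-\bar x)(x_i-\bar x)^{\mathrm T}$. The geodesic path from $\Sigma_0>0$ to $\Sigma_1>0$ is $\Sigma_t=\Sigma_0^{1/2}\{\Sigma_0^{-1/2}\Sigma_1\Sigma_0^{-1/2}\}^t\Sigma_0^{1/2}$, $0\le t\le 1$. A function $F$ on $\Sigma>0$ is strictly g-convex if $F(\Sigma_t)<(1-t)F(\Sigma_0)+tF(\Sigma_1)$ for all $\Sigma_0\ne\Sigma_1$ and $0<t<1$. It is g-coercive if $F(\Sigma)\to\infty$ as $\|\log\Sigma\|_F\to\infty$. A critical point is a point at which the gradient vanishes ($L$ is differentiable here). *)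

theory Defs
  imports "HOL-Analysis.Analysis"
begin

definition pos_def :: "real^'q^'q \<Rightarrow> bool" where
  "pos_def A \<longleftrightarrow> transpose A = A \<and> (\<forall>v. v \<noteq> 0 \<longrightarrow> v \<bullet> (A *v v) > 0)"

definition diag_mat :: "('q \<Rightarrow> real) \<Rightarrow> real^'q^'q" where
  "diag_mat d = (\<chi> i j. if i = j then d i else 0)"

text \<open>
  Functional calculus for a real symmetric matrix: if \<open>A = Q D Q\<^sup>T\<close> with \<open>Q\<close> orthogonal and \<open>D\<close>
  diagonal, then \<open>f\<close> is applied to the diagonal of \<open>D\<close>.  The lemma \<open>mat_fun_eq\<close> below shows that
  the result does not depend on the diagonalization.
\<close>

definition mat_fun :: "(real \<Rightarrow> real) \<Rightarrow> real^'q^'q \<Rightarrow> real^'q^'q" where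
  "mat_fun f A = (THE B. \<exists>Q d. orthogonal_matrix Q \<and> A = Q ** diag_mat d ** transpose Q \<and>
     B = Q ** diag_mat (\<lambda>i. f (d i)) ** transpose Q)"

lemma diag_mat_mult_left: "(diag_mat d ** A) $ i $ j = d i * A $ i $ j"
  by (simp add: diag_mat_def matrix_matrix_mult_def if_distrib [of "\<lambda>x. x * _"] cong: if_cong)

lemma diag_mat_mult_right: "(A ** diag_mat d) $ i $ j = A $ i $ j * d j"
  by (simp add: diag_mat_def matrix_matrix_mult_def if_distrib [of "\<lambda>x. _ * x"] cong: if_cong)

lemma mat_fun_unique:
  fixes Q P :: "real^'q^'q"
  assumes Q: "orthogonal_matrix Q" and P: "orthogonal_matrix P"
    and eq: "Q ** diag_mat d ** transpose Q = P ** diag_mat e ** transpose P"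
  shows "Q ** diag_mat (\<lambda>i. f (d i)) ** transpose Q = P ** diag_mat (\<lambda>i. f (e i)) ** transpose P"
proof -
  define R where "R = transpose P ** Q"
  have Q1: "transpose Q ** Q = mat 1" and Q2: "Q ** transpose Q = mat 1"
    and P1: "transpose P ** P = mat 1" and P2: "P ** transpose P = mat 1"
    using Q P by (auto simp: orthogonal_matrix_def)
  have PR: "P ** R = Q"
    by (simp add: R_def matrix_mul_assoc P2)
  have RQ: "R ** transpose Q = transpose P"
    by (simp add: R_def matrix_mul_assoc [symmetric] Q2)
  have "R ** diag_mat d = transpose P ** (Q ** diag_mat d ** transpose Q) ** Q"
    by (simp add: R_def matrix_mul_assoc [symmetric] Q1)
  also have "\<dots> = (transpose P ** P) ** diag_mat e ** (transpose P ** Q)"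
    by (simp add: eq matrix_mul_assoc)
  also have "\<dots> = diag_mat e ** R"
    by (simp add: P1 R_def)
  finally have comm: "R ** diag_mat d = diag_mat e ** R" .
  have "R $ i $ j * d j = e i * R $ i $ j" for i j
    using arg_cong [OF comm, of "\<lambda>M. M $ i $ j"]
    by (simp add: diag_mat_mult_left diag_mat_mult_right)
  then have "R $ i $ j = 0 \<or> d j = e i" for i j
    by (metis mult.commute mult_cancel_left)
  then have "R ** diag_mat (\<lambda>i. f (d i)) = diag_mat (\<lambda>i. f (e i)) ** R"
    unfolding vec_eq_iff diag_mat_mult_left diag_mat_mult_right
    by (metis mult.commute mult_zero_left)
  then have "P ** (R ** diag_mat (\<lambda>i. f (d i))) ** transpose Q =
      P ** (diag_mat (\<lambda>i. f (e i)) ** R) ** transpose Q"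
    by simp
  then have "(P ** R) ** diag_mat (\<lambda>i. f (d i)) ** transpose Q =
      P ** diag_mat (\<lambda>i. f (e i)) ** (R ** transpose Q)"
    by (simp add: matrix_mul_assoc)
  then show ?thesis
    by (simp add: PR RQ)
qed

lemma mat_fun_eq:
  fixes Q :: "real^'q^'q"
  assumes "orthogonal_matrix Q"
  shows "mat_fun f (Q ** diag_mat d ** transpose Q) =
    Q ** diag_mat (\<lambda>i. f (d i)) ** transpose Q"
  unfolding mat_fun_def
proof (rule the_equality)
  fix B
  assume "\<exists>P e. orthogonal_matrix P \<and>
    Q ** diag_mat d ** transpose Q = P ** diag_mat e ** transpose P \<and>
    B = P ** diag_mat (\<lambda>i. f (e i)) ** transpose P"
  then show "B = Q ** diag_mat (\<lambda>i. f (d i)) ** transpose Q"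
    using mat_fun_unique [OF assms] by metis
qed (use assms in blast)

definition mat_log :: "real^'q^'q \<Rightarrow> real^'q^'q" where
  "mat_log = mat_fun ln"

definition mat_powr :: "real^'q^'q \<Rightarrow> real \<Rightarrow> real^'q^'q" where
  "mat_powr A t = mat_fun (\<lambda>x. x powr t) A"

definition geodesic :: "real^'q^'q \<Rightarrow> real^'q^'q \<Rightarrow> real \<Rightarrow> real^'q^'q" where
  "geodesic A B t = mat_powr A (1/2) **
     mat_powr (mat_powr A (-1/2) ** B ** mat_powr A (-1/2)) t ** mat_powr A (1/2)"

definition strictly_g_convex :: "(real^'q^'q \<Rightarrow> real) \<Rightarrow> bool" where
  "strictly_g_convex F \<longleftrightarrow>
     (\<forall>A B t. pos_def A \<longrightarrow> pos_def B \<longrightarrow> A \<noteq> B \<longrightarrow> 0 < t \<longrightarrow> t < 1 \<longrightarrow>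
        F (geodesic A B t) < (1 - t) * F A + t * F B)"

text \<open>
  The library norm on \<open>real^'q^'q\<close> is the Frobenius norm, and the inner product is the
  corresponding one, the trace of \<open>A\<^sup>T B\<close>.
\<close>

definition g_coercive :: "(real^'q^'q \<Rightarrow> real) \<Rightarrow> bool" where
  "g_coercive F \<longleftrightarrow>
     filterlim F at_top (inf (filtercomap (\<lambda>A. norm (mat_log A)) at_top) (principal {A. pos_def A}))"

text \<open>
  The positive definite matrices are open in the space of symmetric matrices, but not in
  \<open>real^'q^'q\<close>.  Hence the derivative is taken within the set of positive definite matrices, and
  the gradient is required to be symmetric, which makes it unique.
\<close>

definition has_gradient :: "(real^'q^'q \<Rightarrow> real) \<Rightarrow> real^'q^'q \<Rightarrow> real^'q^'q \<Rightarrow> bool" where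
  "has_gradient F G A \<longleftrightarrow> transpose G = G \<and>
     (F has_derivative (\<lambda>H. G \<bullet> H)) (at A within {A. pos_def A})"

definition critical_point :: "(real^'q^'q \<Rightarrow> real) \<Rightarrow> real^'q^'q \<Rightarrow> bool" where
  "critical_point F A \<longleftrightarrow> pos_def A \<and> has_gradient F 0 A"

definition global_minimizer :: "(real^'q^'q \<Rightarrow> real) \<Rightarrow> real^'q^'q \<Rightarrow> bool" where
  "global_minimizer F A \<longleftrightarrow> pos_def A \<and> (\<forall>B. pos_def B \<longrightarrow> F A \<le> F B)"

definition sample_mean :: "nat \<Rightarrow> (nat \<Rightarrow> real^'q) \<Rightarrow> real^'q" where
  "sample_mean n x = (1 / real n) *\<^sub>R (\<Sum>i=1..n. x i)"

definition sample_cov :: "nat \<Rightarrow> (nat \<Rightarrow> real^'q) \<Rightarrow> real^'q^'q" where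
  "sample_cov n x = (1 / real n) *\<^sub>R
     (\<Sum>i=1..n. (columnvector (x i - sample_mean n x) :: real^1^'q) ** rowvector (x i - sample_mean n x))"

definition Pi_Rs :: "real^'q^'q \<Rightarrow> real" where
  "Pi_Rs A = (norm (mat_log A - (ln (det A) / real CARD('q)) *\<^sub>R mat 1))\<^sup>2"

definition L :: "real^'q^'q \<Rightarrow> real \<Rightarrow> real^'q^'q \<Rightarrow> real" where
  "L S \<eta> A = trace (matrix_inv A ** S) + ln (det A) + \<eta> * Pi_Rs A"

end

theory Submission
  imports Defs "HOL-Real_Asymp.Real_Asymp"
begin

text \<open>
  Everything is computed in two kinds of coordinates.  A positive definite matrix has a spectral
  decomposition with eigenvalues \<open>exp (d i)\<close>, and a pair of them has a common congruence \<open>G\<close> along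
  which the geodesic is \<open>conj_diag G (\<lambda>i. exp (t * h i))\<close> (lemma \<open>geodesic_conj_diag\<close>).  In the latter
  coordinates the trace term is a sum of exponentials in \<open>t\<close> and the log-determinant is affine, so
  the only hard point is the penalty.

  The penalty is controlled by the nonpositive curvature of the positive definite cone: the squared
  norm of the logarithm, which is the squared distance to the identity, is convex along geodesics with
  defect at least \<open>t * (1 - t)\<close> times the squared length of the geodesic (\<open>norm_log_geodesic_le\<close>).  This
  follows from the law of cosines \<open>norm_log_congruence_ge\<close>, which in turn is the statement that the
  logarithm does not expand the geodesic distance (\<open>norm_log_diff_le\<close>).  The latter is proved without
  differentiating the logarithm.  If \<open>X\<close> and \<open>Y\<close> have log-eigenvalues \<open>x i\<close> and \<open>y j\<close>, then the squared
  overlaps of their eigenvectors are doubly stochastic weights for which the squared distance of the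
  logarithms is the weighted sum of \<open>(y j - x i)\<^sup>2\<close>, and \<open>trace (matrix_inv X ** Y) + trace (matrix_inv Y ** X)\<close>
  minus twice the order is the weighted sum of \<open>exp (y j - x i) + exp (x i - y j) - 2\<close>.  The scalar inequality between the terms
  gives the infinitesimal statement, and subdividing the geodesic gives the global one.

  The penalty is strictly convex unless the end points are proportional, and then the trace term is
  strictly convex because the sample covariance matrix \<open>S\<close> is not zero; without a penalty the invertibility of \<open>S\<close> suffices
  (\<open>strictly_g_convex_L\<close>).  A lower bound linear in the norm of the logarithm (\<open>L_coercive\<close>) gives
  coercivity and, by compactness in spectral coordinates, a minimizer; strict convexity makes it unique.

  The objective has a gradient at every positive definite matrix (\<open>has_gradient_L\<close>); for the
  log-determinant and the penalty the overlap weights reduce this to a scalar Taylor estimate.  The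
  gradient vanishes at a minimizer, and conversely a critical point of a geodesically convex
  function is a minimizer.
\<close>

section \<open>Spectral decomposition of symmetric matrices\<close>

lemma symmetric_dot:
  fixes A :: "real^'n^'n"
  assumes "transpose A = A"
  shows "(A *v x) \<bullet> y = x \<bullet> (A *v y)"
  by (metis assms dot_lmul_matrix transpose_matrix_vector)

text \<open>
  A vector at which a nonnegative quadratic form vanishes is in its kernel: otherwise a small step
  from \<open>v\<close> in the direction \<open>- A *v v\<close> would make the form negative.  The version relative to an
  invariant subspace serves the construction of eigenvectors.
\<close>

lemma psd_form_zero:
  fixes A :: "real^'n^'n"
  assumes sym: "transpose A = A" and W: "subspace W" and inv: "\<And>x. x \<in> W \<Longrightarrow> A *v x \<in> W"
    and psd: "\<And>x. x \<in> W \<Longrightarrow> x \<bullet> (A *v x) \<ge> 0"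
    and v: "v \<in> W" "v \<bullet> (A *v v) = 0"
  shows "A *v v = 0"
proof -
  define w where "w = A *v v"
  define b where "b = w \<bullet> w"
  define c where "c = w \<bullet> (A *v w)"
  \<comment> \<open>The minimizing step is \<open>- b / c\<close>; adding one covers \<open>c = 0\<close>.\<close>
  define e where "e = - b / (c + 1)"
  have wW: "w \<in> W" using inv v by (simp add: w_def)
  have c0: "c \<ge> 0" using psd[OF wW] by (simp add: c_def)
  have vw: "v \<bullet> (A *v w) = b"
    using symmetric_dot[OF sym, of v w] by (simp add: b_def w_def)
  have "v + e *\<^sub>R w \<in> W" using W v wW by (simp add: subspace_add subspace_mul)
  from psd[OF this] have "0 \<le> 2 * e * b + e^2 * c"
    using v vw by (simp add: matrix_vector_right_distrib matrix_vector_mult_scaleR inner_add_left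
        inner_add_right b_def[symmetric] c_def[symmetric] w_def[symmetric] power2_eq_square
        algebra_simps)
  also have "\<dots> = - (b^2 * (c + 2)) / (c + 1)^2"
  proof -
    have "c + 1 \<noteq> 0" using c0 by simp
    then show ?thesis by (simp add: e_def divide_simps power2_eq_square) algebra
  qed
  finally have "b^2 * (c + 2) \<le> 0"
    using c0 by (simp add: divide_le_0_iff zero_le_divide_iff)
  moreover have "b^2 * (c + 2) \<ge> b^2 * 1" using c0 by (intro mult_left_mono) auto
  ultimately have "b^2 \<le> 0" by linarith
  then show ?thesis by (simp add: b_def w_def)
qed

text \<open>A maximizer of the quadratic form on the unit sphere of an invariant subspace is an eigenvector.\<close>

lemma symmetric_eigenvector_in_subspace:
  fixes A :: "real^'n^'n"
  assumes sym: "transpose A = A" and W: "subspace W" and inv: "\<And>x. x \<in> W \<Longrightarrow> A *v x \<in> W"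
    and ne: "\<exists>x\<in>W. x \<noteq> 0"
  obtains v l where "v \<in> W" "norm v = 1" "A *v v = l *\<^sub>R v"
proof -
  let ?K = "W \<inter> sphere 0 1"
  obtain x where x: "x \<in> W" "x \<noteq> 0" using ne by blast
  have "compact ?K"
    by (intro closed_Int_compact closed_subspace W compact_sphere)
  moreover have "(1 / norm x) *\<^sub>R x \<in> ?K" using x W by (simp add: subspace_mul)
  then have "?K \<noteq> {}" by blast
  moreover have "continuous_on ?K (\<lambda>v. v \<bullet> (A *v v))"
    by (intro continuous_intros linear_continuous_on matrix_vector_mul_bounded_linear)
  ultimately obtain v where v: "v \<in> ?K" and max: "\<And>u. u \<in> ?K \<Longrightarrow> u \<bullet> (A *v u) \<le> v \<bullet> (A *v v)"
    using continuous_attains_sup[of ?K "\<lambda>v. v \<bullet> (A *v v)"] by blast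
  define l where "l = v \<bullet> (A *v v)"
  let ?M = "l *\<^sub>R mat 1 - A"
  have M: "?M *v u = l *\<^sub>R u - A *v u" for u
    by (simp add: matrix_vector_mult_diff_rdistrib scaleR_matrix_vector_assoc[symmetric])
  have "?M *v v = 0"
  proof (rule psd_form_zero[where W = W])
    show "transpose ?M = ?M"
    proof -
      have "A $ j $ i = A $ i $ j" for i j
        using arg_cong[OF sym, of "\<lambda>M. M $ i $ j"] by (simp add: transpose_def)
      then show ?thesis by (simp add: transpose_def vec_eq_iff mat_def)
    qed
    show "?M *v u \<in> W" if "u \<in> W" for u
      using that inv W by (simp add: M subspace_diff subspace_mul)
    show "u \<bullet> (?M *v u) \<ge> 0" if "u \<in> W" for u
    proof (cases "u = 0")
      case False
      let ?u = "(1 / norm u) *\<^sub>R u"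
      have "?u \<in> ?K" using that False W by (simp add: subspace_mul)
      then have "?u \<bullet> (A *v ?u) \<le> l" unfolding l_def by (rule max)
      then have "(u \<bullet> (A *v u)) / (norm u)^2 \<le> l"
        by (simp add: matrix_vector_mult_scaleR power2_eq_square)
      then have "u \<bullet> (A *v u) \<le> l * (u \<bullet> u)"
        using False by (simp add: divide_le_eq power2_norm_eq_inner)
      then show ?thesis by (simp add: M inner_diff_right)
    qed simp
    show "v \<bullet> (?M *v v) = 0"
      using v unfolding M by (simp add: inner_diff_right l_def norm_eq_1)
  qed (use v W in auto)
  then have "A *v v = l *\<^sub>R v" by (simp add: M)
  then show ?thesis using that v by auto
qed

text \<open>
  The orthogonal complement of eigenvectors is invariant under a symmetric matrix, so a further
  eigenvector can be found in it.
\<close>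

lemma symmetric_orthonormal_eigenvectors:
  fixes A :: "real^'n^'n"
  assumes sym: "transpose A = A" and "k \<le> CARD('n)"
  shows "\<exists>S. finite S \<and> card S = k \<and> pairwise orthogonal S \<and>
    (\<forall>v\<in>S. norm v = 1 \<and> (\<exists>l. A *v v = l *\<^sub>R v))"
  using assms(2)
proof (induction k)
  case 0
  show ?case by (rule exI[of _ "{}"]) simp
next
  case (Suc k)
  then obtain S where S: "finite S" "card S = k" "pairwise orthogonal S"
    and eig: "\<And>v. v \<in> S \<Longrightarrow> norm v = 1 \<and> (\<exists>l. A *v v = l *\<^sub>R v)" by force
  define W where "W = {x. \<forall>s\<in>S. x \<bullet> s = 0}"
  have "dim S < DIM(real^'n)"
    using dim_le_card[of S S] S Suc.prems by (simp add: span_superset)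
  then obtain x where x: "x \<noteq> 0" "\<And>y. y \<in> span S \<Longrightarrow> orthogonal x y"
    using orthogonal_to_subspace_exists by blast
  have "subspace W"
    by (auto simp: W_def subspace_def inner_add_left)
  moreover have "A *v y \<in> W" if "y \<in> W" for y
    unfolding W_def mem_Collect_eq symmetric_dot[OF sym]
  proof
    fix s assume "s \<in> S"
    with eig obtain l where "A *v s = l *\<^sub>R s" by blast
    then show "y \<bullet> (A *v s) = 0" using that \<open>s \<in> S\<close> by (simp add: W_def)
  qed
  moreover have "\<exists>x\<in>W. x \<noteq> 0"
    using x by (auto simp: W_def orthogonal_def intro: span_base)
  ultimately obtain v l where v: "v \<in> W" "norm v = 1" "A *v v = l *\<^sub>R v"
    using symmetric_eigenvector_in_subspace[OF sym] by blast
  have "v \<notin> S"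
  proof
    assume "v \<in> S"
    then have "v \<bullet> v = 0" using v by (auto simp: W_def)
    then show False using v by simp
  qed
  show ?case
  proof (intro exI[of _ "insert v S"] conjI)
    show "pairwise orthogonal (insert v S)"
      using S v by (auto simp: pairwise_insert W_def orthogonal_def inner_commute)
  qed (use S v eig \<open>v \<notin> S\<close> in auto)
qed

text \<open>
  With \<open>G\<close> orthogonal this is a spectral decomposition.  With \<open>G\<close> merely invertible it is a
  congruence, and \<open>conj_diag G (\<lambda>i. exp (t * h i))\<close> runs along a geodesic as \<open>t\<close> varies.
\<close>

definition conj_diag :: "real^'n^'n \<Rightarrow> ('n \<Rightarrow> real) \<Rightarrow> real^'n^'n" where
  "conj_diag G a = G ** diag_mat a ** transpose G"

theorem spectral_theorem:
  fixes A :: "real^'n^'n"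
  assumes sym: "transpose A = A"
  obtains Q a where "orthogonal_matrix Q" "A = conj_diag Q a"
proof -
  obtain S where S: "finite S" "card S = CARD('n)" "pairwise orthogonal S"
    and eig: "\<And>v. v \<in> S \<Longrightarrow> norm v = 1 \<and> (\<exists>l. A *v v = l *\<^sub>R v)"
    using symmetric_orthonormal_eigenvectors[OF sym order_refl] by blast
  obtain f where f: "bij_betw f (UNIV::'n set) S"
    by (metis S finite_class.finite_UNIV finite_same_card_bij)
  have fS: "f i \<in> S" for i using f by (auto simp: bij_betw_def)
  define Q :: "real^'n^'n" where "Q = (\<chi> i j. f j $ i)"
  have col: "column j Q = f j" for j by (simp add: Q_def column_def)
  have Q: "orthogonal_matrix Q"
    unfolding orthogonal_matrix_orthonormal_columns col
    using pairwiseD[OF S(3) fS fS] eig fS bij_betw_imp_inj_on[OF f] by (auto simp: inj_eq)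
  have "\<forall>j. \<exists>l. A *v f j = l *\<^sub>R f j" using eig fS by blast
  then obtain a where a: "\<And>j. A *v f j = a j *\<^sub>R f j" unfolding choice_iff by blast
  have "A ** Q = Q ** diag_mat a"
  proof -
    have "(A ** Q) $ i $ j = (A *v f j) $ i" for i j
      by (simp add: matrix_matrix_mult_def matrix_vector_mult_def Q_def)
    then show ?thesis
      by (simp add: vec_eq_iff diag_mat_mult_right a) (simp add: Q_def mult.commute)
  qed
  then have "A ** (Q ** transpose Q) = conj_diag Q a"
    by (simp add: conj_diag_def matrix_mul_assoc)
  then show ?thesis using Q that by (simp add: orthogonal_matrix_def)
qed

section \<open>Calculus of congruences of diagonal matrices\<close>

lemma diag_mat_mult: "diag_mat a ** diag_mat b = diag_mat (\<lambda>i. a i * b i)"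
  by (simp add: vec_eq_iff diag_mat_mult_left) (simp add: diag_mat_def)

lemma transpose_diag_mat: "transpose (diag_mat a) = diag_mat a"
  by (simp add: vec_eq_iff diag_mat_def transpose_def)

lemma diag_mat_one: "diag_mat (\<lambda>i. 1) = mat 1"
  by (simp add: vec_eq_iff diag_mat_def mat_def)

lemma transpose_conj_diag: "transpose (conj_diag G a) = conj_diag G a"
  by (simp add: conj_diag_def matrix_transpose_mul transpose_diag_mat matrix_mul_assoc)

lemma conj_diag_mult:
  assumes "orthogonal_matrix Q"
  shows "conj_diag Q a ** conj_diag Q b = conj_diag Q (\<lambda>i. a i * b i)"
proof -
  have "conj_diag Q a ** conj_diag Q b
      = Q ** (diag_mat a ** (transpose Q ** Q) ** diag_mat b) ** transpose Q"
    by (simp add: conj_diag_def matrix_mul_assoc)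
  then show ?thesis
    using assms by (simp add: orthogonal_matrix_def diag_mat_mult conj_diag_def)
qed

lemma conj_diag_one: "conj_diag G (\<lambda>i. 1) = G ** transpose G"
  by (simp add: conj_diag_def diag_mat_one)

lemma conj_diag_congruence: "M ** conj_diag G a ** transpose M = conj_diag (M ** G) a"
  by (simp add: conj_diag_def matrix_transpose_mul matrix_mul_assoc)

lemma conj_diag_nth: "conj_diag G a $ i $ j = (\<Sum>k\<in>UNIV. G $ i $ k * a k * G $ j $ k)"
  unfolding conj_diag_def
  by (subst matrix_matrix_mult_def) (simp add: diag_mat_mult_right transpose_def)

lemma conj_diag_mult_diag: "conj_diag (G ** diag_mat b) a = conj_diag G (\<lambda>i. (b i)\<^sup>2 * a i)"
  by (simp add: vec_eq_iff conj_diag_nth diag_mat_mult_right power2_eq_square mult_ac)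

lemma conj_diag_diff: "conj_diag G a - conj_diag G b = conj_diag G (\<lambda>i. a i - b i)"
  by (simp add: vec_eq_iff conj_diag_nth sum_subtractf algebra_simps)

lemma conj_diag_scale: "conj_diag G (\<lambda>i. c * a i) = c *\<^sub>R conj_diag G a"
  by (simp add: vec_eq_iff conj_diag_nth sum_distrib_left algebra_simps)

lemma conj_diag_const:
  assumes "orthogonal_matrix Q"
  shows "conj_diag Q (\<lambda>i. c) = c *\<^sub>R mat 1"
  using conj_diag_scale[of Q c "\<lambda>i. 1"] assms by (simp add: conj_diag_one orthogonal_matrix_def)

lemma matrix_inv_eqI:
  fixes A B :: "real^'n^'n"
  assumes "B ** A = mat 1"
  shows "matrix_inv A = B"
proof -
  have AB: "A ** B = mat 1" using assms by (rule matrix_left_right_inverse[THEN iffD1])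
  have *: "A ** matrix_inv A = mat 1 \<and> matrix_inv A ** A = mat 1"
    unfolding matrix_inv_def
    by (rule someI[of "\<lambda>B. A ** B = mat 1 \<and> B ** A = mat 1" B]) (use assms AB in blast)
  have "matrix_inv A = (B ** A) ** matrix_inv A" using assms by simp
  also have "\<dots> = B" using * by (simp add: matrix_mul_assoc[symmetric])
  finally show ?thesis .
qed

lemma matrix_inv_conj_diag:
  assumes N: "N ** G = mat 1" and a: "\<And>i. a i \<noteq> 0"
  shows "matrix_inv (conj_diag G a) = conj_diag (transpose N) (\<lambda>i. inverse (a i))"
proof (rule matrix_inv_eqI)
  have N': "transpose G ** transpose N = mat 1"
    using arg_cong[OF N, of transpose] by (simp add: matrix_transpose_mul)
  then have N'': "transpose N ** transpose G = mat 1"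
    by (rule matrix_left_right_inverse[THEN iffD1])
  have "conj_diag (transpose N) (\<lambda>i. inverse (a i)) ** conj_diag G a
     = transpose N ** (diag_mat (\<lambda>i. inverse (a i)) ** (N ** G) ** diag_mat a) ** transpose G"
    by (simp add: conj_diag_def matrix_mul_assoc)
  also have "\<dots> = mat 1"
    using a by (simp add: N diag_mat_mult diag_mat_one N'')
  finally show "conj_diag (transpose N) (\<lambda>i. inverse (a i)) ** conj_diag G a = mat 1" .
qed

lemma quadratic_form_conj_diag:
  "v \<bullet> (conj_diag G a *v v) = (\<Sum>i\<in>UNIV. a i * ((transpose G *v v) $ i)\<^sup>2)"
proof -
  have "v \<bullet> (conj_diag G a *v v) = (v v* G) \<bullet> (diag_mat a *v (transpose G *v v))"
    by (simp only: conj_diag_def dot_lmul_matrix matrix_vector_mul_assoc[symmetric])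
  also have "\<dots> = (transpose G *v v) \<bullet> (diag_mat a *v (transpose G *v v))"
    by simp
  also have "\<dots> = (\<Sum>i\<in>UNIV. a i * ((transpose G *v v) $ i)\<^sup>2)"
    by (simp add: inner_vec_def diag_mat_def matrix_vector_mult_def power2_eq_square
        if_distrib [of "\<lambda>x. x * _"] mult_ac cong: if_cong)
  finally show ?thesis .
qed

lemma pos_def_conj_diag:
  fixes G :: "real^'n^'n"
  assumes G: "invertible G" and a: "\<And>i. a i > 0"
  shows "pos_def (conj_diag G a)"
  unfolding pos_def_def
proof (intro conjI allI impI)
  show "transpose (conj_diag G a) = conj_diag G a" by (rule transpose_conj_diag)
  fix v :: "real^'n" assume "v \<noteq> 0"
  let ?u = "transpose G *v v"
  have "?u \<noteq> 0"
  proof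
    assume u: "?u = 0"
    obtain N where N: "G ** N = mat 1" using G by (auto simp: invertible_def)
    have "transpose N ** transpose G = mat 1"
      using arg_cong[OF N, of transpose] by (simp add: matrix_transpose_mul)
    then have "v = transpose N *v ?u"
      by (simp only: matrix_vector_mul_assoc matrix_vector_mul_lid)
    then show False using \<open>v \<noteq> 0\<close> u by simp
  qed
  then obtain j where "?u $ j \<noteq> 0" by (auto simp: vec_eq_iff)
  then have "0 < a j * (?u $ j)\<^sup>2" using a by simp
  also have "\<dots> \<le> (\<Sum>i\<in>UNIV. a i * (?u $ i)\<^sup>2)"
    by (rule member_le_sum) (auto intro: mult_nonneg_nonneg less_imp_le[OF a])
  finally show "v \<bullet> (conj_diag G a *v v) > 0" by (simp only: quadratic_form_conj_diag)
qed

lemma invertible_orthogonal: "orthogonal_matrix (Q :: real^'n^'n) \<Longrightarrow> invertible Q"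
  by (auto simp: orthogonal_matrix_def invertible_def)

lemma orthogonal_matrix_cancel:
  assumes "orthogonal_matrix (Q :: real^'n^'n)"
  shows "transpose Q *v (Q *v v) = v"
  using assms by (simp only: matrix_vector_mul_assoc orthogonal_matrix_def matrix_vector_mul_lid)

lemma quadratic_form_column:
  assumes "orthogonal_matrix Q"
  shows "column i Q \<bullet> (conj_diag Q a *v column i Q) = a i"
proof -
  have "transpose Q *v column i Q = axis i 1"
    using orthogonal_matrix_cancel[OF assms, of "axis i 1"]
    by (simp only: matrix_vector_mult_basis)
  then show ?thesis
    unfolding quadratic_form_conj_diag
    by (simp add: axis_def if_distrib[of "\<lambda>x. x\<^sup>2"] if_distrib[of "\<lambda>x. _ * x"] cong: if_cong)
qed

lemma pos_def_spectral:
  fixes A :: "real^'n^'n"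
  assumes "pos_def A"
  obtains Q d where "orthogonal_matrix Q" "A = conj_diag Q (\<lambda>i. exp (d i))"
proof -
  have "transpose A = A" using assms by (simp add: pos_def_def)
  then obtain Q a where Q: "orthogonal_matrix Q" and A: "A = conj_diag Q a"
    by (rule spectral_theorem)
  have "a i > 0" for i
  proof -
    have "norm (column i Q) = 1" using Q by (simp add: orthogonal_matrix_orthonormal_columns)
    then have "column i Q \<noteq> 0" by auto
    then show ?thesis
      using assms quadratic_form_column[OF Q, of i a] unfolding pos_def_def A by metis
  qed
  then have "A = conj_diag Q (\<lambda>i. exp (ln (a i)))" by (simp add: A)
  then show ?thesis by (rule that[OF Q])
qed

lemma mat_log_conj_diag:
  assumes "orthogonal_matrix Q"
  shows "mat_log (conj_diag Q (\<lambda>i. exp (d i))) = conj_diag Q d"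
  using mat_fun_eq[OF assms, of ln] by (simp add: mat_log_def conj_diag_def)

lemma mat_powr_conj_diag:
  assumes "orthogonal_matrix Q"
  shows "mat_powr (conj_diag Q (\<lambda>i. exp (d i))) t = conj_diag Q (\<lambda>i. exp (t * d i))"
  using mat_fun_eq[OF assms, of "\<lambda>x. x powr t"]
  by (simp add: mat_powr_def conj_diag_def powr_def)

lemma det_conj_diag: "det (conj_diag G a) = (det G)\<^sup>2 * (\<Prod>i\<in>UNIV. a i)"
proof -
  have "det (diag_mat a) = (\<Prod>i\<in>UNIV. a i)"
    by (subst det_diagonal) (auto simp: diag_mat_def)
  then show ?thesis by (simp add: conj_diag_def det_mul power2_eq_square)
qed

lemma ln_det_conj_diag:
  fixes G :: "real^'n^'n"
  assumes "invertible G"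
  shows "ln (det (conj_diag G (\<lambda>i. exp (d i)))) = ln ((det G)\<^sup>2) + (\<Sum>i\<in>UNIV. d i)"
  using assms
  by (simp add: det_conj_diag ln_mult prod_pos ln_prod invertible_det_nz exp_sum[symmetric])

lemma det_orthogonal_squared: "orthogonal_matrix (Q :: real^'n^'n) \<Longrightarrow> (det Q)\<^sup>2 = 1"
  using det_orthogonal_matrix[of Q] by auto

section \<open>Overlaps of two eigenbases\<close>

text \<open>
  The squared entries of \<open>transpose Q ** P\<close> form a doubly stochastic array.  Weighted sums over it
  express Frobenius inner products of matrices that are diagonal in different bases, so that scalar
  inequalities between eigenvalues become matrix inequalities without any commutation hypothesis.
\<close>

definition overlap :: "real^'n^'n \<Rightarrow> real^'n^'n \<Rightarrow> 'n \<Rightarrow> 'n \<Rightarrow> real" where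
  "overlap Q P i j = ((transpose Q ** P) $ i $ j)\<^sup>2"

lemma overlap_nonneg: "overlap Q P i j \<ge> 0"
  by (simp add: overlap_def)

lemma overlap_commute: "overlap P Q j i = overlap Q P i j"
proof -
  have "transpose P ** Q = transpose (transpose Q ** P)" by (simp add: matrix_transpose_mul)
  then show ?thesis by (simp add: overlap_def transpose_def)
qed

lemma sum_overlap_row:
  assumes "orthogonal_matrix Q" "orthogonal_matrix P"
  shows "(\<Sum>j\<in>UNIV. overlap Q P i j) = 1"
proof -
  have "orthogonal_matrix (transpose Q ** P)" using assms by (simp add: orthogonal_matrix_mul)
  then have "((transpose Q ** P) ** transpose (transpose Q ** P)) $ i $ i = 1"
    unfolding orthogonal_matrix_def by (simp add: mat_def)
  then show ?thesis
    unfolding overlap_def power2_eq_square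
    by (subst (asm) matrix_matrix_mult_def) (simp add: transpose_def)
qed

lemma sum_overlap_col:
  assumes "orthogonal_matrix Q" "orthogonal_matrix P"
  shows "(\<Sum>i\<in>UNIV. overlap Q P i j) = 1"
  using sum_overlap_row[OF assms(2,1), of j] by (simp add: overlap_commute[of P])

lemma inner_eq_trace: "A \<bullet> B = trace (transpose A ** B)" for A B :: "real^'n^'n"
  unfolding inner_vec_def trace_def matrix_matrix_mult_def
  by (subst sum.swap) (simp add: transpose_def)

lemma inner_conj_diag:
  "conj_diag Q a \<bullet> conj_diag P b = (\<Sum>i\<in>UNIV. \<Sum>j\<in>UNIV. overlap Q P i j * (a i * b j))"
proof -
  define W where "W = transpose Q ** P"
  have "conj_diag Q a \<bullet> conj_diag P b
      = trace (Q ** (diag_mat a ** W ** diag_mat b ** transpose P))"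
    unfolding inner_eq_trace transpose_conj_diag
    by (simp add: conj_diag_def W_def matrix_mul_assoc)
  also have "\<dots> = trace (diag_mat a ** W ** diag_mat b ** transpose W)"
    unfolding W_def by (subst trace_mul_sym) (simp add: matrix_transpose_mul matrix_mul_assoc)
  also have "\<dots> = (\<Sum>i\<in>UNIV. \<Sum>j\<in>UNIV. a i * W $ i $ j * b j * W $ i $ j)"
    unfolding trace_def
    by (subst matrix_matrix_mult_def)
      (simp add: diag_mat_mult_right diag_mat_mult_left transpose_def)
  finally show ?thesis
    by (simp add: overlap_def W_def power2_eq_square mult_ac)
qed

lemma sum_overlap_left:
  assumes "orthogonal_matrix Q" "orthogonal_matrix P"
  shows "(\<Sum>i\<in>UNIV. \<Sum>j\<in>UNIV. overlap Q P i j * f i) = (\<Sum>i\<in>UNIV. f i)"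
  using sum_overlap_row[OF assms] by (simp flip: sum_distrib_right)

lemma sum_overlap_right:
  assumes "orthogonal_matrix Q" "orthogonal_matrix P"
  shows "(\<Sum>i\<in>UNIV. \<Sum>j\<in>UNIV. overlap Q P i j * f j) = (\<Sum>j\<in>UNIV. f j)"
  using sum_overlap_col[OF assms] by (subst sum.swap) (simp flip: sum_distrib_right)

lemma inner_conj_diag_same:
  assumes "orthogonal_matrix Q"
  shows "conj_diag Q a \<bullet> conj_diag Q b = (\<Sum>i\<in>UNIV. a i * b i)"
proof -
  have "overlap Q Q i j = (if i = j then 1 else 0)" for i j
    using assms by (simp add: overlap_def orthogonal_matrix_def mat_def)
  then show ?thesis by (simp add: inner_conj_diag if_distrib[of "\<lambda>x. x * _"] cong: if_cong)
qed

lemma norm_conj_diag: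
  assumes "orthogonal_matrix Q"
  shows "(norm (conj_diag Q a))\<^sup>2 = (\<Sum>i\<in>UNIV. (a i)\<^sup>2)"
  using inner_conj_diag_same[OF assms, of a a]
  unfolding power2_norm_eq_inner by (simp add: power2_eq_square)

lemma norm_diff_conj_diag:
  assumes Q: "orthogonal_matrix Q" and P: "orthogonal_matrix P"
  shows "(norm (conj_diag Q a - conj_diag P b))\<^sup>2
    = (\<Sum>i\<in>UNIV. \<Sum>j\<in>UNIV. overlap Q P i j * (a i - b j)\<^sup>2)"
proof -
  have "(norm (conj_diag Q a - conj_diag P b))\<^sup>2
    = (norm (conj_diag Q a))\<^sup>2 - 2 * (conj_diag Q a \<bullet> conj_diag P b) + (norm (conj_diag P b))\<^sup>2"
    by (simp add: power2_norm_eq_inner inner_diff_left inner_diff_right inner_commute)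
  also have "\<dots> = (\<Sum>i\<in>UNIV. \<Sum>j\<in>UNIV. overlap Q P i j * (a i)\<^sup>2)
     - 2 * (\<Sum>i\<in>UNIV. \<Sum>j\<in>UNIV. overlap Q P i j * (a i * b j))
     + (\<Sum>i\<in>UNIV. \<Sum>j\<in>UNIV. overlap Q P i j * (b j)\<^sup>2)"
    by (simp only: norm_conj_diag Q P inner_conj_diag sum_overlap_left sum_overlap_right)
  also have "\<dots> = (\<Sum>i\<in>UNIV. \<Sum>j\<in>UNIV. overlap Q P i j * (a i - b j)\<^sup>2)"
    by (simp add: sum_distrib_left sum_subtractf[symmetric] sum.distrib[symmetric] power2_diff
        algebra_simps)
  finally show ?thesis .
qed

lemma pos_def_conj_diag_exp:
  fixes G :: "real^'n^'n"
  assumes "invertible G"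
  shows "pos_def (conj_diag G (\<lambda>i. exp (d i)))"
  by (rule pos_def_conj_diag[OF assms]) simp

lemma matrix_inv_spectral:
  assumes "orthogonal_matrix Q"
  shows "matrix_inv (conj_diag Q (\<lambda>i. exp (d i))) = conj_diag Q (\<lambda>i. exp (- d i))"
  using matrix_inv_conj_diag[of "transpose Q" Q "\<lambda>i. exp (d i)"] assms
  by (simp add: orthogonal_matrix_def exp_minus)

section \<open>The matrix logarithm does not expand the geodesic distance\<close>

lemma two_add_square_le_exp_sum: "2 + u\<^sup>2 \<le> exp u + exp (- u)" for u :: real
proof -
  have pos: "v \<le> exp (v / 2) - exp (- v / 2)" if "v \<ge> 0" for v :: real
  proof -
    let ?f = "\<lambda>v::real. exp (v / 2) - exp (- v / 2) - v"
    have "?f 0 \<le> ?f v"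
    proof (rule DERIV_nonneg_imp_nondecreasing[OF that])
      fix x :: real
      have "(?f has_real_derivative (exp (x / 2) + exp (- x / 2)) / 2 - 1) (at x)"
        by (auto intro!: derivative_eq_intros simp: field_simps)
      moreover have "(exp (x / 2) + exp (- x / 2)) / 2 - 1 \<ge> 0"
      proof -
        have "a + b \<ge> 2" if "1 + y \<le> a" "1 + - y \<le> b" for a b y :: real
          using that by linarith
        from this[OF exp_ge_add_one_self exp_ge_add_one_self, of "x / 2"] show ?thesis by simp
      qed
      ultimately show "\<exists>y. (?f has_real_derivative y) (at x) \<and> 0 \<le> y" by blast
    qed
    then show ?thesis by simp
  qed
  have "\<bar>u\<bar> \<le> exp (\<bar>u\<bar> / 2) - exp (- \<bar>u\<bar> / 2)" by (rule pos) simp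
  then have "\<bar>u\<bar>\<^sup>2 \<le> (exp (\<bar>u\<bar> / 2) - exp (- \<bar>u\<bar> / 2))\<^sup>2"
    by (rule power_mono) simp
  also have "\<dots> = exp \<bar>u\<bar> + exp (- \<bar>u\<bar>) - 2"
    unfolding power2_diff unfolding power2_eq_square mult.assoc mult_exp_exp by simp
  also have "\<dots> = exp u + exp (- u) - 2" by (cases "u \<ge> 0") auto
  finally show ?thesis by simp
qed

text \<open>
  The right-hand side is the sum of \<open>exp h + exp (- h) - 2\<close> over the logarithms \<open>h\<close> of the
  eigenvalues of \<open>matrix_inv X ** Y\<close>, which is the squared geodesic distance up to fourth order.
  Expanded in the overlaps of the two eigenbases, the inequality reduces termwise to
  \<open>u\<^sup>2 \<le> exp u + exp (- u) - 2\<close>.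
\<close>

lemma norm_log_diff_le_trace:
  fixes X Y :: "real^'n^'n"
  assumes "pos_def X" "pos_def Y"
  shows "(norm (mat_log Y - mat_log X))\<^sup>2
    \<le> trace (matrix_inv X ** Y) + trace (matrix_inv Y ** X) - 2 * real CARD('n)"
proof -
  obtain Q x where Q: "orthogonal_matrix Q" and X: "X = conj_diag Q (\<lambda>i. exp (x i))"
    using pos_def_spectral[OF assms(1)] .
  obtain P y where P: "orthogonal_matrix P" and Y: "Y = conj_diag P (\<lambda>i. exp (y i))"
    using pos_def_spectral[OF assms(2)] .
  have XY: "trace (matrix_inv X ** Y)
      = (\<Sum>i\<in>UNIV. \<Sum>j\<in>UNIV. overlap Q P i j * exp (y j - x i))"
    using inner_conj_diag[of Q "\<lambda>i. exp (- x i)" P "\<lambda>i. exp (y i)"]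
    by (simp add: X Y matrix_inv_spectral Q inner_eq_trace transpose_conj_diag
        mult_exp_exp)
  have YX: "trace (matrix_inv Y ** X)
      = (\<Sum>i\<in>UNIV. \<Sum>j\<in>UNIV. overlap Q P i j * exp (- (y j - x i)))"
    using inner_conj_diag[of Q "\<lambda>i. exp (x i)" P "\<lambda>i. exp (- y i)"]
    by (simp add: X Y matrix_inv_spectral P inner_eq_trace transpose_conj_diag
        mult_exp_exp trace_mul_sym[of "conj_diag P _"])
  have one: "real CARD('n) = (\<Sum>i\<in>UNIV. \<Sum>j\<in>UNIV. overlap Q P i j * 1)"
    using sum_overlap_left[OF Q P, of "\<lambda>i. 1"] by simp
  have "(norm (mat_log Y - mat_log X))\<^sup>2 = (norm (mat_log X - mat_log Y))\<^sup>2"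
    by (simp only: norm_minus_commute)
  also have "\<dots> = (\<Sum>i\<in>UNIV. \<Sum>j\<in>UNIV. overlap Q P i j * (y j - x i)\<^sup>2)"
    by (simp add: X Y mat_log_conj_diag P Q norm_diff_conj_diag
        power2_commute[of "y _"])
  also have "\<dots> \<le> (\<Sum>i\<in>UNIV. \<Sum>j\<in>UNIV. overlap Q P i j * (exp (y j - x i) + exp (- (y j - x i)) - 2))"
    by (intro sum_mono mult_left_mono overlap_nonneg) (smt (verit) two_add_square_le_exp_sum)
  also have "\<dots> = trace (matrix_inv X ** Y) + trace (matrix_inv Y ** X) - 2 * real CARD('n)"
    unfolding XY YX one sum_distrib_left sum_subtractf[symmetric] sum.distrib[symmetric]
    by (simp add: algebra_simps)
  finally show ?thesis .
qed

lemma trace_inv_conj_diag: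
  fixes G :: "real^'n^'n"
  assumes "invertible G"
  shows "trace (matrix_inv (conj_diag G (\<lambda>i. exp (a i))) ** conj_diag G (\<lambda>i. exp (b i)))
    = (\<Sum>i\<in>UNIV. exp (b i - a i))"
proof -
  obtain N where N: "N ** G = mat 1" using assms by (auto simp: invertible_def)
  have NG: "transpose G ** transpose N = mat 1"
    using arg_cong[OF N, of transpose] by (simp add: matrix_transpose_mul)
  have "trace (matrix_inv (conj_diag G (\<lambda>i. exp (a i))) ** conj_diag G (\<lambda>i. exp (b i)))
    = trace (transpose N ** (diag_mat (\<lambda>i. inverse (exp (a i))) ** (N ** G) **
        diag_mat (\<lambda>i. exp (b i)) ** transpose G))"
    by (simp add: matrix_inv_conj_diag[OF N]) (simp add: conj_diag_def matrix_mul_assoc)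
  also have "\<dots> = trace (diag_mat (\<lambda>i. exp (b i - a i)) ** (transpose G ** transpose N))"
    by (subst trace_mul_sym)
      (simp add: N diag_mat_mult matrix_mul_assoc exp_diff divide_inverse mult.commute)
  also have "\<dots> = (\<Sum>i\<in>UNIV. exp (b i - a i))"
    unfolding NG by (simp add: trace_def diag_mat_def)
  finally show ?thesis .
qed

text \<open>
  The geodesic distance of the two matrices is the norm of \<open>k\<close>.  The preceding lemma is only
  infinitesimally sharp, so it is applied to the \<open>n\<close> steps of an equal subdivision of the geodesic
  between them; the error vanishes as \<open>n\<close> grows.
\<close>

theorem norm_log_diff_le:
  fixes G :: "real^'n^'n"
  assumes G: "invertible G"
  shows "(norm (mat_log (conj_diag G (\<lambda>i. exp (k i))) - mat_log (conj_diag G (\<lambda>i. 1))))\<^sup>2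
    \<le> (\<Sum>i\<in>UNIV. (k i)\<^sup>2)"
proof -
  define X where "X s = conj_diag G (\<lambda>i. exp (s * k i))" for s
  have step: "(norm (mat_log (X r) - mat_log (X s)))\<^sup>2
      \<le> (\<Sum>i\<in>UNIV. exp ((r - s) * k i) + exp (- ((r - s) * k i)) - 2)" for r s
    using norm_log_diff_le_trace[of "X s" "X r"] pos_def_conj_diag_exp[OF G]
    by (simp add: X_def trace_inv_conj_diag[OF G] sum.distrib sum_subtractf algebra_simps)
  have subdiv: "(norm (mat_log (X 1) - mat_log (X 0)))\<^sup>2
      \<le> (\<Sum>i\<in>UNIV. (real n)\<^sup>2 * (exp (k i / real n) + exp (- (k i / real n)) - 2))"
    if "n > 0" for n
  proof -
    let ?E = "\<Sum>i\<in>UNIV. exp (k i / real n) + exp (- (k i / real n)) - 2"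
    have "mat_log (X 1) - mat_log (X 0)
        = (\<Sum>j<n. mat_log (X (real (Suc j) / n)) - mat_log (X (real j / n)))"
      using that by (subst sum_lessThan_telescope) simp
    then have "norm (mat_log (X 1) - mat_log (X 0))
        \<le> (\<Sum>j<n. norm (mat_log (X (real (Suc j) / n)) - mat_log (X (real j / n))))"
      by (simp only: norm_sum)
    also have "\<dots> \<le> (\<Sum>j<n. sqrt ?E)"
    proof (rule sum_mono)
      fix j
      have "real (Suc j) / n - real j / n = 1 / n" using that by (simp add: field_simps)
      then show "norm (mat_log (X (real (Suc j) / n)) - mat_log (X (real j / n))) \<le> sqrt ?E"
        using step[of "real (Suc j) / n" "real j / n"] by (intro real_le_rsqrt) simp
    qed
    finally have "norm (mat_log (X 1) - mat_log (X 0)) \<le> real n * sqrt ?E" by simp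
    then have "(norm (mat_log (X 1) - mat_log (X 0)))\<^sup>2 \<le> (real n * sqrt ?E)\<^sup>2"
      by (rule power_mono) simp
    also have "\<dots> = (real n)\<^sup>2 * ?E"
    proof -
      have "?E \<ge> 0"
      proof (rule sum_nonneg)
        fix i show "0 \<le> exp (k i / real n) + exp (- (k i / real n)) - 2"
          using two_add_square_le_exp_sum[of "k i / real n"]
          by (smt (verit) zero_le_power2)
      qed
      then show ?thesis by (simp add: power_mult_distrib)
    qed
    finally show ?thesis by (simp add: sum_distrib_left)
  qed
  have lim: "(\<lambda>n. (real n)\<^sup>2 * (exp (c / real n) + exp (- (c / real n)) - 2)) \<longlonglongrightarrow> c * c"
    for c :: real
  proof -
    consider "c = 0" | "c > 0" | "c < 0" by linarith
    then show ?thesis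
    proof cases
      case 1 then show ?thesis by simp
    next
      case 2 then show ?thesis by real_asymp
    next
      case 3 then show ?thesis by real_asymp
    qed
  qed
  have "(norm (mat_log (X 1) - mat_log (X 0)))\<^sup>2 \<le> (\<Sum>i\<in>UNIV. (k i)\<^sup>2)"
  proof (rule tendsto_lowerbound)
    show "(\<lambda>n. \<Sum>i\<in>UNIV. (real n)\<^sup>2 * (exp (k i / real n) + exp (- (k i / real n)) - 2))
        \<longlonglongrightarrow> (\<Sum>i\<in>UNIV. (k i)\<^sup>2)"
      unfolding power2_eq_square[of "k _"] by (intro tendsto_sum lim)
    show "\<forall>\<^sub>F n in sequentially. (norm (mat_log (X 1) - mat_log (X 0)))\<^sup>2
      \<le> (\<Sum>i\<in>UNIV. (real n)\<^sup>2 * (exp (k i / real n) + exp (- (k i / real n)) - 2))"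
      using eventually_gt_at_top[of 0] by eventually_elim (rule subdiv)
  qed simp
  then show ?thesis by (simp add: X_def)
qed

section \<open>Geodesics and the semi-parallelogram inequality\<close>

text \<open>
  Two positive definite matrices are diagonalized simultaneously by a congruence, which turns the
  geodesic into linear motion of the exponents.
\<close>

lemma geodesic_conj_diag:
  fixes A B :: "real^'n^'n"
  assumes "pos_def A" "pos_def B"
  obtains G h where "invertible G" "A = conj_diag G (\<lambda>i. 1)" "B = conj_diag G (\<lambda>i. exp (h i))"
    "\<And>t. geodesic A B t = conj_diag G (\<lambda>i. exp (t * h i))"
proof -
  obtain Q a where Q: "orthogonal_matrix Q" and A: "A = conj_diag Q (\<lambda>i. exp (a i))"
    using pos_def_spectral[OF assms(1)] .
  obtain P b where P: "orthogonal_matrix P" and B: "B = conj_diag P (\<lambda>i. exp (b i))"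
    using pos_def_spectral[OF assms(2)] .
  define R where "R = mat_powr A (1/2)"
  define R' where "R' = mat_powr A (-1/2)"
  have R: "R = conj_diag Q (\<lambda>i. exp (1/2 * a i))" and R': "R' = conj_diag Q (\<lambda>i. exp (-1/2 * a i))"
    unfolding R_def R'_def A by (rule mat_powr_conj_diag[OF Q])+
  have tR: "transpose R = R" "transpose R' = R'"
    unfolding R R' by (rule transpose_conj_diag)+
  have RR: "R ** R = A" and RR': "R ** R' = mat 1" and R'R: "R' ** R = mat 1"
    using conj_diag_const[OF Q, of 1]
    unfolding R R' A conj_diag_mult[OF Q] by (simp_all add: mult_exp_exp)
  have Z0: "R' ** B ** R' = conj_diag (R' ** P) (\<lambda>i. exp (b i))"
    using conj_diag_congruence[of R' P "\<lambda>i. exp (b i)"] by (simp add: tR B)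
  have "invertible (R' ** P)"
    using RR' R'R invertible_orthogonal[OF P]
    by (intro invertible_mult) (auto simp: invertible_def)
  then have "pos_def (R' ** B ** R')"
    unfolding Z0 by (rule pos_def_conj_diag_exp)
  then obtain V h where V: "orthogonal_matrix V" and Z: "R' ** B ** R' = conj_diag V (\<lambda>i. exp (h i))"
    by (rule pos_def_spectral)
  have geo: "geodesic A B t = conj_diag (R ** V) (\<lambda>i. exp (t * h i))" for t
    unfolding geodesic_def R_def[symmetric] R'_def[symmetric] Z mat_powr_conj_diag[OF V]
    using conj_diag_congruence[of R V] by (simp add: tR)
  show ?thesis
  proof (rule that[of "R ** V" h])
    show "invertible (R ** V)"
      using RR' R'R invertible_orthogonal[OF V]
      by (intro invertible_mult) (auto simp: invertible_def)
    have "conj_diag (R ** V) (\<lambda>i. 1) = R ** conj_diag V (\<lambda>i. 1) ** transpose R"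
      by (rule conj_diag_congruence[symmetric])
    then show "A = conj_diag (R ** V) (\<lambda>i. 1)"
      using conj_diag_const[OF V, of 1] RR by (simp add: tR)
    have "conj_diag (R ** V) (\<lambda>i. exp (h i)) = R ** (R' ** B ** R') ** R"
      using conj_diag_congruence[of R V "\<lambda>i. exp (h i)"] by (simp add: tR Z)
    also have "\<dots> = (R ** R') ** B ** (R' ** R)" by (simp only: matrix_mul_assoc)
    finally show "B = conj_diag (R ** V) (\<lambda>i. exp (h i))" by (simp add: RR' R'R)
  qed (rule geo)
qed

text \<open>
  Law of cosines: in the geodesic triangle with vertices \<open>mat 1\<close>, \<open>M ** transpose M\<close> and
  \<open>conj_diag M (\<lambda>i. exp (y i))\<close>, the side opposite the second vertex is at least as long as in the
  flat triangle with the same adjacent sides and angle.  The congruence by \<open>N\<close>, an isometry, moves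
  the second vertex to the identity, where the non-expansion of the logarithm compares with the flat metric.
\<close>

lemma norm_log_congruence_ge:
  fixes M N :: "real^'n^'n"
  assumes NM: "N ** M = mat 1"
  shows "(norm (mat_log (conj_diag N (\<lambda>i. 1)) - diag_mat y))\<^sup>2
    \<le> (norm (mat_log (conj_diag M (\<lambda>i. exp (y i)))))\<^sup>2"
proof -
  have MN: "M ** N = mat 1" using NM by (rule matrix_left_right_inverse[THEN iffD1])
  then have inv: "invertible M" "invertible N" using NM by (auto simp: invertible_def)
  obtain V a where V: "orthogonal_matrix V"
    and A: "conj_diag M (\<lambda>i. exp (y i)) = conj_diag V (\<lambda>i. exp (a i))"
    using pos_def_spectral[OF pos_def_conj_diag_exp[OF inv(1)]] .
  have id: "conj_diag (mat 1) b = diag_mat b" for b :: "'n \<Rightarrow> real"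
    by (simp add: conj_diag_def)
  have "conj_diag (N ** V) (\<lambda>i. exp (a i)) = N ** conj_diag M (\<lambda>i. exp (y i)) ** transpose N"
    unfolding A by (rule conj_diag_congruence[symmetric])
  also have "\<dots> = conj_diag (mat 1) (\<lambda>i. exp (y i))"
    unfolding conj_diag_congruence NM ..
  finally have 1: "mat_log (conj_diag (N ** V) (\<lambda>i. exp (a i))) = diag_mat y"
    using mat_log_conj_diag[OF orthogonal_matrix_id, of y] by (simp only: id)
  have "conj_diag (N ** V) (\<lambda>i. 1) = N ** conj_diag V (\<lambda>i. 1) ** transpose N"
    by (rule conj_diag_congruence[symmetric])
  then have 2: "conj_diag (N ** V) (\<lambda>i. 1) = conj_diag N (\<lambda>i. 1)"
    using V by (simp add: conj_diag_one orthogonal_matrix_def)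
  have "invertible (N ** V)" by (intro invertible_mult inv invertible_orthogonal V)
  from norm_log_diff_le[OF this, of a] show ?thesis
    unfolding 1 2 A mat_log_conj_diag[OF V] norm_conj_diag[OF V]
    by (simp add: norm_minus_commute)
qed

text \<open>
  Nonpositive curvature, as seen from the identity.  The law of cosines is applied to the two
  triangles into which the point at parameter \<open>t\<close> cuts the triangle of the identity and the end
  points.  Their angles at this point are supplementary, so the convex combination of the two flat
  inequalities cancels the inner products.
\<close>

theorem norm_log_geodesic_le:
  fixes G :: "real^'n^'n"
  assumes G: "invertible G" and t: "0 \<le> t" "t \<le> 1"
  shows "(norm (mat_log (conj_diag G (\<lambda>i. exp (t * h i)))))\<^sup>2
    \<le> (1 - t) * (norm (mat_log (conj_diag G (\<lambda>i. 1))))\<^sup>2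
      + t * (norm (mat_log (conj_diag G (\<lambda>i. exp (h i)))))\<^sup>2
      - t * (1 - t) * (\<Sum>i\<in>UNIV. (h i)\<^sup>2)"
proof -
  \<comment> \<open>\<open>M ** transpose M\<close> is the point of the geodesic at parameter \<open>t\<close>; seen from it, the end
     points have exponents \<open>- t * h\<close> and \<open>(1 - t) * h\<close>.\<close>
  define M where "M = G ** diag_mat (\<lambda>i. exp (t * h i / 2))"
  have M: "conj_diag M (\<lambda>i. exp (b i)) = conj_diag G (\<lambda>i. exp (t * h i + b i))" for b
    unfolding M_def conj_diag_mult_diag
    by (simp add: exp_add[symmetric] power2_eq_square)
  obtain G' where G': "G' ** G = mat 1" using G by (auto simp: invertible_def)
  define N where "N = diag_mat (\<lambda>i. exp (- (t * h i / 2))) ** G'"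
  have "N ** M = diag_mat (\<lambda>i. exp (- (t * h i / 2))) ** (G' ** G) ** diag_mat (\<lambda>i. exp (t * h i / 2))"
    by (simp add: N_def M_def matrix_mul_assoc)
  then have NM: "N ** M = mat 1"
    by (simp add: G' diag_mat_mult mult_exp_exp diag_mat_one)
  then have MN: "M ** N = mat 1" by (rule matrix_left_right_inverse[THEN iffD1])
  define U where "U = mat_log (conj_diag N (\<lambda>i. 1))"
  let ?D = "diag_mat h"
  have D: "diag_mat (\<lambda>i. c * h i) = c *\<^sub>R ?D" for c by (simp add: vec_eq_iff diag_mat_def)
  have normD: "?D \<bullet> ?D = (\<Sum>i\<in>UNIV. (h i)\<^sup>2)"
    using inner_conj_diag_same[OF orthogonal_matrix_id, of h h]
    by (simp add: conj_diag_def power2_eq_square)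
  have C: "(norm (mat_log (conj_diag G (\<lambda>i. exp (t * h i)))))\<^sup>2 \<le> U \<bullet> U"
    using norm_log_congruence_ge[OF MN, of "\<lambda>i. 0"] M[of "\<lambda>i. 0"] D[of 0]
    by (simp add: U_def power2_norm_eq_inner)
  have A: "(norm (mat_log (conj_diag G (\<lambda>i. 1))))\<^sup>2 \<ge> (U + t *\<^sub>R ?D) \<bullet> (U + t *\<^sub>R ?D)"
    using norm_log_congruence_ge[OF NM, of "\<lambda>i. - t * h i"] M[of "\<lambda>i. - t * h i"] D[of "- t"]
    by (simp add: U_def power2_norm_eq_inner)
  have B: "(norm (mat_log (conj_diag G (\<lambda>i. exp (h i)))))\<^sup>2
      \<ge> (U - (1 - t) *\<^sub>R ?D) \<bullet> (U - (1 - t) *\<^sub>R ?D)"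
  proof -
    have "t * h i + (1 - t) * h i = h i" for i by (simp add: algebra_simps)
    then show ?thesis
      using norm_log_congruence_ge[OF NM, of "\<lambda>i. (1 - t) * h i"] M[of "\<lambda>i. (1 - t) * h i"]
      by (simp add: U_def power2_norm_eq_inner D)
  qed
  have "(1 - t) * ((U + t *\<^sub>R ?D) \<bullet> (U + t *\<^sub>R ?D))
      + t * ((U - (1 - t) *\<^sub>R ?D) \<bullet> (U - (1 - t) *\<^sub>R ?D)) = U \<bullet> U + t * (1 - t) * (?D \<bullet> ?D)"
    by (simp add: inner_add_left inner_add_right inner_diff_left inner_diff_right inner_commute)
      (simp add: algebra_simps power2_eq_square)
  moreover have "(1 - t) * ((U + t *\<^sub>R ?D) \<bullet> (U + t *\<^sub>R ?D)) \<le> (1 - t) * (norm (mat_log (conj_diag G (\<lambda>i. 1))))\<^sup>2"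
    using A t by (intro mult_left_mono) auto
  moreover have "t * ((U - (1 - t) *\<^sub>R ?D) \<bullet> (U - (1 - t) *\<^sub>R ?D))
      \<le> t * (norm (mat_log (conj_diag G (\<lambda>i. exp (h i)))))\<^sup>2"
    using B t by (intro mult_left_mono) auto
  ultimately show ?thesis using C unfolding normD by linarith
qed

section \<open>The objective in congruence coordinates\<close>

definition psd :: "real^'n^'n \<Rightarrow> bool" where
  "psd S \<longleftrightarrow> transpose S = S \<and> (\<forall>v. 0 \<le> v \<bullet> (S *v v))"

lemma psd_quadratic_zero:
  assumes "psd S" "v \<bullet> (S *v v) = 0"
  shows "S *v v = 0"
  using assms psd_form_zero[of S UNIV v] by (simp add: psd_def)

lemma psd_sample_cov: "psd (sample_cov n x)"
proof -
  let ?y = "\<lambda>i. x i - sample_mean n x"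
  have nth: "sample_cov n x $ a $ b = (1 / real n) * (\<Sum>i=1..n. ?y i $ a * ?y i $ b)" for a b
    unfolding sample_cov_def
    by (simp add: matrix_matrix_mult_def columnvector_def rowvector_def)
  have "v \<bullet> (sample_cov n x *v v) = (1 / real n) * (\<Sum>i=1..n. (?y i \<bullet> v)\<^sup>2)" for v
  proof -
    have "v \<bullet> (sample_cov n x *v v)
        = (\<Sum>a\<in>UNIV. \<Sum>b\<in>UNIV. \<Sum>i=1..n. (1 / real n) * (v $ a * ?y i $ a * (?y i $ b * v $ b)))"
      by (simp add: inner_vec_def matrix_vector_mult_def nth sum_distrib_left sum_distrib_right mult_ac)
    also have "\<dots> = (\<Sum>i=1..n. \<Sum>a\<in>UNIV. \<Sum>b\<in>UNIV. (1 / real n) * (v $ a * ?y i $ a * (?y i $ b * v $ b)))"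
      by (subst sum.swap[of _ UNIV "{1..n}"], subst sum.swap[of _ UNIV "{1..n}"]) simp
    also have "\<dots> = (1 / real n) * (\<Sum>i=1..n. (?y i \<bullet> v)\<^sup>2)"
      by (simp add: inner_vec_def power2_eq_square sum_product sum_distrib_left mult_ac)
    finally show ?thesis .
  qed
  then show ?thesis
    by (simp add: psd_def sum_nonneg) (simp add: vec_eq_iff transpose_def nth mult.commute)
qed

lemma inner_conj_diag_quadratic:
  "conj_diag H d \<bullet> S = (\<Sum>k\<in>UNIV. d k * (column k H \<bullet> (S *v column k H)))"
proof -
  have "conj_diag H d \<bullet> S
      = (\<Sum>i\<in>UNIV. \<Sum>j\<in>UNIV. \<Sum>k\<in>UNIV. d k * (H $ i $ k * (S $ i $ j * H $ j $ k)))"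
    by (simp add: inner_vec_def conj_diag_nth sum_distrib_right sum_distrib_left mult_ac)
  also have "\<dots> = (\<Sum>i\<in>UNIV. \<Sum>k\<in>UNIV. \<Sum>j\<in>UNIV. d k * (H $ i $ k * (S $ i $ j * H $ j $ k)))"
    by (intro sum.cong refl sum.swap)
  also have "\<dots> = (\<Sum>k\<in>UNIV. \<Sum>i\<in>UNIV. \<Sum>j\<in>UNIV. d k * (H $ i $ k * (S $ i $ j * H $ j $ k)))"
    by (rule sum.swap)
  also have "\<dots> = (\<Sum>k\<in>UNIV. d k * (column k H \<bullet> (S *v column k H)))"
    by (simp add: inner_vec_def column_def matrix_vector_mult_def sum_distrib_left)
  finally show ?thesis .
qed

lemma trace_inv_mult:
  fixes G N S :: "real^'n^'n"
  assumes "N ** G = mat 1"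
  shows "trace (matrix_inv (conj_diag G (\<lambda>i. exp (d i))) ** S)
    = (\<Sum>i\<in>UNIV. exp (- d i) * (row i N \<bullet> (S *v row i N)))"
  using inner_conj_diag_quadratic[of "transpose N" "\<lambda>i. exp (- d i)" S]
  by (simp add: matrix_inv_conj_diag[OF assms] inner_eq_trace transpose_conj_diag exp_minus)

lemma sum_square_deviation:
  fixes h :: "'n::finite \<Rightarrow> real"
  defines "m \<equiv> (\<Sum>i\<in>UNIV. h i) / real CARD('n)"
  shows "(\<Sum>i\<in>UNIV. (h i)\<^sup>2) - (\<Sum>i\<in>UNIV. h i)\<^sup>2 / real CARD('n) = (\<Sum>i\<in>UNIV. (h i - m)\<^sup>2)"
proof -
  have s: "(\<Sum>i\<in>UNIV. h i) = real CARD('n) * m" by (simp add: m_def)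
  have "(\<Sum>i\<in>UNIV. (h i - m)\<^sup>2)
      = (\<Sum>i\<in>UNIV. (h i)\<^sup>2) - 2 * m * (\<Sum>i\<in>UNIV. h i) + real CARD('n) * m\<^sup>2"
    by (simp add: power2_diff sum.distrib sum_subtractf sum_distrib_left[symmetric]
        sum_distrib_right[symmetric] mult_ac)
  then show ?thesis unfolding s by (simp add: power2_eq_square)
qed

lemma Pi_Rs_spectral:
  fixes Q :: "real^'n^'n"
  assumes Q: "orthogonal_matrix Q"
  shows "Pi_Rs (conj_diag Q (\<lambda>i. exp (d i)))
    = (\<Sum>i\<in>UNIV. (d i)\<^sup>2) - (\<Sum>i\<in>UNIV. d i)\<^sup>2 / real CARD('n)"
proof -
  let ?m = "(\<Sum>i\<in>UNIV. d i) / real CARD('n)"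
  have "ln (det (conj_diag Q (\<lambda>i. exp (d i)))) = (\<Sum>i\<in>UNIV. d i)"
    using ln_det_conj_diag[OF invertible_orthogonal[OF Q]] det_orthogonal_squared[OF Q] by simp
  moreover have "conj_diag Q d - ?m *\<^sub>R mat 1 = conj_diag Q (\<lambda>i. d i - ?m)"
    by (simp only: conj_diag_const[OF Q, symmetric] conj_diag_diff)
  ultimately show ?thesis
    by (simp add: Pi_Rs_def mat_log_conj_diag[OF Q] norm_conj_diag[OF Q] sum_square_deviation)
qed

lemma Pi_Rs_pos_def:
  fixes A :: "real^'n^'n"
  assumes "pos_def A"
  shows "Pi_Rs A = (norm (mat_log A))\<^sup>2 - (ln (det A))\<^sup>2 / real CARD('n)"
proof -
  obtain Q d where Q: "orthogonal_matrix Q" and A: "A = conj_diag Q (\<lambda>i. exp (d i))"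
    using pos_def_spectral[OF assms] .
  have "ln (det A) = (\<Sum>i\<in>UNIV. d i)"
    using ln_det_conj_diag[OF invertible_orthogonal[OF Q]] det_orthogonal_squared[OF Q] A by simp
  then show ?thesis
    by (simp add: A Pi_Rs_spectral[OF Q] mat_log_conj_diag[OF Q] norm_conj_diag[OF Q])
qed

text \<open>
  In spectral coordinates the objective is an explicit continuous function of the eigenbasis and the
  logarithms of the eigenvalues.  Coercivity and the existence of a minimizer are read off from it.
\<close>

lemma L_spectral:
  fixes Q :: "real^'n^'n"
  assumes Q: "orthogonal_matrix Q"
  shows "L S \<eta> (conj_diag Q (\<lambda>i. exp (d i)))
    = (\<Sum>i\<in>UNIV. exp (- d i) * (column i Q \<bullet> (S *v column i Q))) + (\<Sum>i\<in>UNIV. d i)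
      + \<eta> * ((\<Sum>i\<in>UNIV. (d i)\<^sup>2) - (\<Sum>i\<in>UNIV. d i)\<^sup>2 / real CARD('n))"
proof -
  have "ln (det (conj_diag Q (\<lambda>i. exp (d i)))) = (\<Sum>i\<in>UNIV. d i)"
    using ln_det_conj_diag[OF invertible_orthogonal[OF Q]] det_orthogonal_squared[OF Q] by simp
  moreover have "transpose Q ** Q = mat 1" using Q by (simp add: orthogonal_matrix_def)
  ultimately show ?thesis
    using trace_inv_mult[of "transpose Q" Q d S] by (simp add: L_def Pi_Rs_spectral[OF Q])
qed

section \<open>Strict geodesic convexity\<close>

text \<open>
  The penalty is the squared norm of the logarithm minus the squared log-determinant over the
  dimension.  The latter is the square of an affine function along a geodesic, so its convexity
  defect is known exactly and can be subtracted.  What remains measures the deviation of the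
  exponents \<open>h\<close> from their mean, and vanishes just when the end points are proportional.
\<close>

lemma Pi_Rs_geodesic_le:
  fixes G :: "real^'n^'n" and h :: "'n \<Rightarrow> real"
  assumes G: "invertible G" and t: "0 \<le> t" "t \<le> 1"
  defines "m \<equiv> (\<Sum>i\<in>UNIV. h i) / real CARD('n)"
  shows "Pi_Rs (conj_diag G (\<lambda>i. exp (t * h i)))
    \<le> (1 - t) * Pi_Rs (conj_diag G (\<lambda>i. 1)) + t * Pi_Rs (conj_diag G (\<lambda>i. exp (h i)))
      - t * (1 - t) * (\<Sum>i\<in>UNIV. (h i - m)\<^sup>2)"
proof -
  let ?q = "real CARD('n)"
  define c where "c = ln ((det G)\<^sup>2)"
  define s where "s = (\<Sum>i\<in>UNIV. h i)"
  have ln: "ln (det (conj_diag G (\<lambda>i. exp (r * h i)))) = c + r * s" for r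
    using ln_det_conj_diag[OF G, of "\<lambda>i. r * h i"] by (simp add: c_def s_def sum_distrib_left)
  have pd: "pos_def (conj_diag G (\<lambda>i. exp (r * h i)))" for r
    by (rule pos_def_conj_diag_exp[OF G])
  have "(c + t * s)\<^sup>2 = (1 - t) * c\<^sup>2 + t * (c + s)\<^sup>2 - t * (1 - t) * s\<^sup>2"
    by (simp add: power2_eq_square algebra_simps)
  then have "(c + t * s)\<^sup>2 / ?q = (1 - t) * (c\<^sup>2 / ?q) + t * ((c + s)\<^sup>2 / ?q) - t * (1 - t) * (s\<^sup>2 / ?q)"
    by (simp add: diff_divide_distrib add_divide_distrib)
  moreover have "(\<Sum>i\<in>UNIV. (h i - m)\<^sup>2) = (\<Sum>i\<in>UNIV. (h i)\<^sup>2) - s\<^sup>2 / ?q"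
    unfolding m_def s_def by (rule sum_square_deviation[symmetric])
  ultimately show ?thesis
    using norm_log_geodesic_le[OF G t, of h] Pi_Rs_pos_def[OF pd, of t] Pi_Rs_pos_def[OF pd, of 0]
      Pi_Rs_pos_def[OF pd, of 1] ln[of t] ln[of 0] ln[of 1]
    by (simp add: right_diff_distrib)
qed

lemma exp_gt_add_one:
  fixes x :: real
  assumes "x \<noteq> 0"
  shows "1 + x < exp x"
proof (cases "1 + x / 2 \<ge> 0")
  case True
  have "1 + x < (1 + x / 2)\<^sup>2" using assms
    by (simp add: power2_eq_square algebra_simps zero_less_mult_iff linorder_neq_iff disj_commute)
  also have "\<dots> \<le> (exp (x / 2))\<^sup>2" using True by (intro power_mono exp_ge_add_one_self)
  also have "\<dots> = exp x" by (simp add: power2_eq_square mult_exp_exp)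
  finally show ?thesis .
next
  case False
  then show ?thesis using exp_gt_zero[of x] by linarith
qed

lemma exp_strictly_convex:
  fixes y t :: real
  assumes "y \<noteq> 0" "0 < t" "t < 1"
  shows "exp (t * y) < (1 - t) + t * exp y"
proof -
  let ?z = "t * y"
  have "(1 - t) * (1 - ?z) < (1 - t) * exp (- ?z)"
    using exp_gt_add_one[of "- ?z"] assms by simp
  moreover have "t * (1 + (y - ?z)) \<le> t * exp (y - ?z)"
    using assms by (intro mult_left_mono exp_ge_add_one_self) simp
  moreover have "(1 - t) * (1 - ?z) + t * (1 + (y - ?z)) = 1" by (simp add: algebra_simps)
  ultimately have "1 < (1 - t) * exp (- ?z) + t * exp (y - ?z)" by linarith
  then have "exp ?z * 1 < exp ?z * ((1 - t) * exp (- ?z) + t * exp (y - ?z))"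
    by (intro mult_strict_left_mono) simp_all
  also have "\<dots> = (1 - t) * (exp ?z * exp (- ?z)) + t * (exp ?z * exp (y - ?z))"
    by (simp add: algebra_simps)
  finally show ?thesis by (simp add: mult_exp_exp)
qed

lemma psd_row_form_pos:
  fixes N G S :: "real^'n^'n"
  assumes S: "psd S" "S \<noteq> 0" and NG: "N ** G = mat 1"
  shows "\<exists>i. row i N \<bullet> (S *v row i N) > 0"
proof (rule ccontr)
  assume neg: "\<not> ?thesis"
  have 0: "S *v row i N = 0" for i
  proof (rule psd_quadratic_zero[OF S(1)])
    show "row i N \<bullet> (S *v row i N) = 0"
      using neg S(1) by (metis antisym_conv1 linorder_not_less psd_def)
  qed
  have "(S ** transpose N) $ a $ i = (S *v row i N) $ a" for a i
    by (simp add: matrix_matrix_mult_def matrix_vector_mult_def transpose_def row_def)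
  then have "S ** transpose N = 0" by (simp add: vec_eq_iff 0)
  then have "S ** (transpose N ** transpose G) = 0" by (simp add: matrix_mul_assoc)
  moreover have "transpose N ** transpose G = mat 1"
  proof (rule matrix_left_right_inverse[THEN iffD1])
    show "transpose G ** transpose N = mat 1"
      using arg_cong[OF NG, of transpose] by (simp add: matrix_transpose_mul)
  qed
  ultimately show False using S by simp
qed

lemma psd_invertible_form_pos:
  fixes S :: "real^'n^'n"
  assumes S: "psd S" "invertible S" and v: "v \<noteq> 0"
  shows "v \<bullet> (S *v v) > 0"
proof -
  have "S *v v \<noteq> 0"
  proof
    assume "S *v v = 0"
    then have "S *v v = S *v 0" by simp
    with inj_matrix_vector_mult[OF S(2)] have "v = 0" by (rule injD)
    then show False using v by simp
  qed
  then have "v \<bullet> (S *v v) \<noteq> 0" using psd_quadratic_zero[OF S(1)] by blast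
  moreover have "v \<bullet> (S *v v) \<ge> 0" using S(1) by (simp add: psd_def)
  ultimately show ?thesis by simp
qed

lemma row_left_inverse_nonzero:
  fixes N G :: "real^'n^'n"
  assumes "N ** G = mat 1"
  shows "row i N \<noteq> 0"
proof
  assume "row i N = 0"
  then have "N $ i = 0" by (simp add: row_def vec_eq_iff)
  then have "(N ** G) $ i $ i = 0" by (simp add: matrix_matrix_mult_def)
  then show False by (simp add: assms mat_def)
qed

text \<open>
  The trace term is a sum of exponentials in \<open>t\<close> with nonnegative weights \<open>c\<close>.  It is strictly convex
  as soon as one exponent with positive weight is nonzero, which holds when \<open>S\<close> is invertible, and
  also when all exponents are equal, since not all weights vanish.  In the remaining case the
  exponents are not all equal and \<open>\<eta> > 0\<close>, so the penalty is strictly convex.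
\<close>

theorem strictly_g_convex_L:
  fixes S :: "real^'n^'n"
  assumes S: "psd S" "S \<noteq> 0" and eta: "\<eta> \<ge> 0" "\<not> invertible S \<Longrightarrow> \<eta> > 0"
  shows "strictly_g_convex (L S \<eta>)"
  unfolding strictly_g_convex_def
proof (intro allI impI)
  fix A B :: "real^'n^'n" and t :: real
  assume A: "pos_def A" and B: "pos_def B" and AB: "A \<noteq> B" and t: "0 < t" "t < 1"
  obtain G h where G: "invertible G" and A: "A = conj_diag G (\<lambda>i. 1)"
    and B: "B = conj_diag G (\<lambda>i. exp (h i))"
    and geo: "geodesic A B t = conj_diag G (\<lambda>i. exp (t * h i))"
    using geodesic_conj_diag[OF A B] by metis
  obtain N where N: "N ** G = mat 1" using G by (auto simp: invertible_def)
  \<comment> \<open>The weights of the exponentials in the trace term.\<close>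
  define c where "c i = row i N \<bullet> (S *v row i N)" for i
  define m where "m = (\<Sum>i\<in>UNIV. h i) / real CARD('n)"
  let ?V = "\<Sum>i\<in>UNIV. (h i - m)\<^sup>2"
  let ?T = "\<lambda>X. trace (matrix_inv X ** S)"
  have c0: "c i \<ge> 0" for i using S by (simp add: c_def psd_def)
  have h: "\<exists>i. h i \<noteq> 0"
  proof (rule ccontr)
    assume "\<nexists>i. h i \<noteq> 0"
    then show False using AB A B by simp
  qed
  have T: "?T (conj_diag G (\<lambda>i. exp (r * h i))) = (\<Sum>i\<in>UNIV. exp (r * - h i) * c i)" for r
    using trace_inv_mult[OF N, of "\<lambda>i. r * h i" S] by (simp add: c_def)
  have D: "ln (det (conj_diag G (\<lambda>i. exp (r * h i)))) = ln ((det G)\<^sup>2) + r * (\<Sum>i\<in>UNIV. h i)" for r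
    using ln_det_conj_diag[OF G, of "\<lambda>i. r * h i"] by (simp add: sum_distrib_left)
  have Dt: "ln (det (geodesic A B t)) = (1 - t) * ln (det A) + t * ln (det B)"
    using D[of t] D[of 0] D[of 1] by (simp add: A B geo[unfolded A B] algebra_simps)
  have P: "Pi_Rs (geodesic A B t) \<le> (1 - t) * Pi_Rs A + t * Pi_Rs B - t * (1 - t) * ?V"
    using Pi_Rs_geodesic_le[OF G, of t h] t by (simp add: A B geo[unfolded A B] m_def)
  have TA: "?T A = (\<Sum>i\<in>UNIV. c i)" using T[of 0] by (simp add: A)
  have TB: "?T B = (\<Sum>i\<in>UNIV. exp (- h i) * c i)" using T[of 1] by (simp add: B)
  have Tt: "?T (geodesic A B t) = (\<Sum>i\<in>UNIV. exp (t * - h i) * c i)" using T[of t] by (simp only: geo)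
  have split: "(1 - t) * ?T A + t * ?T B = (\<Sum>i\<in>UNIV. ((1 - t) + t * exp (- h i)) * c i)"
    unfolding TA TB by (simp add: sum_distrib_left sum.distrib[symmetric] algebra_simps)
  have le: "exp (t * - h i) * c i \<le> ((1 - t) + t * exp (- h i)) * c i" for i
  proof (cases "h i = 0")
    case False
    then show ?thesis
      using exp_strictly_convex[of "- h i" t] t c0 by (intro mult_right_mono) auto
  qed simp
  have Tle: "?T (geodesic A B t) \<le> (1 - t) * ?T A + t * ?T B"
    unfolding split Tt by (intro sum_mono le)
  have Tless: "?T (geodesic A B t) < (1 - t) * ?T A + t * ?T B" if "h j \<noteq> 0" "c j > 0" for j
    unfolding split Tt
  proof (rule sum_strict_mono_ex1)
    show "\<exists>i\<in>UNIV. exp (t * - h i) * c i < ((1 - t) + t * exp (- h i)) * c i"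
      using exp_strictly_convex[of "- h j" t] t that by (intro bexI[of _ j] mult_strict_right_mono) auto
  qed (use le in auto)
  have Ple: "\<eta> * Pi_Rs (geodesic A B t) \<le> \<eta> * ((1 - t) * Pi_Rs A + t * Pi_Rs B - t * (1 - t) * ?V)"
    using P eta(1) by (rule mult_left_mono)
  have "?T (geodesic A B t) < (1 - t) * ?T A + t * ?T B \<or> \<eta> * (t * (1 - t) * ?V) > 0"
  proof (cases "\<exists>j. h j \<noteq> 0 \<and> c j > 0")
    case True
    then show ?thesis using Tless by blast
  next
    case False
    have "\<not> invertible S"
      using False h psd_invertible_form_pos[OF S(1) _ row_left_inverse_nonzero[OF N]]
      unfolding c_def by blast
    then have "\<eta> > 0" by (rule eta(2))
    moreover have "?V > 0"
    proof (rule ccontr)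
      assume "\<not> ?V > 0"
      then have "?V = 0" by (smt (verit) sum_nonneg zero_le_power2)
      then have eq: "h i = m" for i by (simp add: sum_nonneg_eq_0_iff)
      obtain j where "c j > 0" using psd_row_form_pos[OF S N] unfolding c_def by blast
      then show False using False h eq by metis
    qed
    ultimately show ?thesis using t by simp
  qed
  moreover have "\<eta> * (t * (1 - t) * ?V) \<ge> 0"
    using eta(1) t by (intro mult_nonneg_nonneg sum_nonneg) auto
  ultimately show "L S \<eta> (geodesic A B t) < (1 - t) * L S \<eta> A + t * L S \<eta> B"
    using Tle Ple Dt unfolding L_def by (auto simp: algebra_simps)
qed

section \<open>Coercivity and existence of a minimizer\<close>

lemma exp_dominates_linear:
  fixes \<tau> k :: real
  assumes \<tau>: "\<tau> > 0" and k: "k \<ge> 1"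
  shows "\<bar>v\<bar> - (k + 1)\<^sup>2 / (2 * \<tau>) \<le> \<tau> * exp v - k * v"
proof (cases "v \<ge> 0")
  case True
  have "0 \<le> (\<tau> * v - (k + 1))\<^sup>2 / (2 * \<tau>)" using \<tau> by simp
  also have "\<dots> = \<tau> * (v\<^sup>2 / 2) - (k + 1) * v + (k + 1)\<^sup>2 / (2 * \<tau>)"
    using \<tau> by (simp add: power2_diff field_simps power2_eq_square)
  also have "\<tau> * (v\<^sup>2 / 2) \<le> \<tau> * exp v"
    using \<tau> True exp_lower_Taylor_quadratic[OF True] by (intro mult_left_mono) auto
  finally show ?thesis using True by (simp add: algebra_simps)
next
  case False
  have "k * v \<le> 1 * v" using k False by (intro mult_right_mono_neg) auto
  moreover have "\<tau> * exp v \<ge> 0" "(k + 1)\<^sup>2 / (2 * \<tau>) \<ge> 0" using \<tau> by auto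
  ultimately show ?thesis using False by linarith
qed

lemma norm_mat_log_spectral:
  assumes "orthogonal_matrix Q"
  shows "norm (mat_log (conj_diag Q (\<lambda>i. exp (d i)))) = L2_set d UNIV"
  using norm_conj_diag[OF assms, of d]
  by (simp add: mat_log_conj_diag[OF assms] L2_set_def real_sqrt_unique)

lemma psd_invertible_form_bound:
  fixes S :: "real^'n^'n"
  assumes S: "psd S" "invertible S"
  obtains m where "m > 0" "\<And>v. norm v = 1 \<Longrightarrow> m \<le> v \<bullet> (S *v v)"
proof -
  have "continuous_on (sphere 0 1) (\<lambda>v. v \<bullet> (S *v v))"
    by (intro continuous_intros linear_continuous_on matrix_vector_mul_bounded_linear)
  moreover have "axis undefined 1 \<in> sphere (0::real^'n) 1" by simp
  then have "sphere (0::real^'n) 1 \<noteq> {}" by blast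
  ultimately obtain u where u: "u \<in> sphere 0 1"
    and min: "\<And>v. v \<in> sphere 0 1 \<Longrightarrow> u \<bullet> (S *v u) \<le> v \<bullet> (S *v v)"
    using continuous_attains_inf[OF compact_sphere] by blast
  have "u \<noteq> 0" using u by auto
  then have "u \<bullet> (S *v u) > 0" by (rule psd_invertible_form_pos[OF S])
  then show ?thesis using that min by auto
qed

lemma L_coercive_invertible:
  fixes S :: "real^'n^'n"
  assumes S: "psd S" "invertible S" and eta: "\<eta> \<ge> 0"
  shows "\<exists>c. \<forall>A. pos_def A \<longrightarrow> norm (mat_log A) - c \<le> L S \<eta> A"
proof -
  obtain m where m: "m > 0" "\<And>v. norm v = 1 \<Longrightarrow> m \<le> v \<bullet> (S *v v)"
    using psd_invertible_form_bound[OF S] by blast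
  define c where "c = (1 + 1)\<^sup>2 / (2 * m)"
  show ?thesis
  proof (intro exI[of _ "real CARD('n) * c"] allI impI)
    fix A :: "real^'n^'n" assume "pos_def A"
    then obtain Q d where Q: "orthogonal_matrix Q" and A: "A = conj_diag Q (\<lambda>i. exp (d i))"
      by (rule pos_def_spectral)
    have "norm (mat_log A) - real CARD('n) * c \<le> (\<Sum>i\<in>UNIV. \<bar>d i\<bar> - c)"
      using L2_set_le_sum_abs[of d UNIV] by (simp add: A norm_mat_log_spectral[OF Q] sum_subtractf)
    also have "\<dots> \<le> (\<Sum>i\<in>UNIV. exp (- d i) * (column i Q \<bullet> (S *v column i Q)) + d i)"
    proof (rule sum_mono)
      fix i
      have "norm (column i Q) = 1" using Q by (simp add: orthogonal_matrix_orthonormal_columns)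
      then have "m * exp (- d i) \<le> exp (- d i) * (column i Q \<bullet> (S *v column i Q))"
        using m(2) by (simp add: mult.commute)
      then show "\<bar>d i\<bar> - c \<le> exp (- d i) * (column i Q \<bullet> (S *v column i Q)) + d i"
        using exp_dominates_linear[OF m(1) order_refl, of "- d i"] unfolding c_def by linarith
    qed
    also have "\<dots> \<le> L S \<eta> A"
      using eta by (simp add: A L_spectral[OF Q] sum_square_deviation sum.distrib sum_nonneg)
    finally show "norm (mat_log A) - real CARD('n) * c \<le> L S \<eta> A" .
  qed
qed

lemma psd_trace_pos:
  fixes S :: "real^'n^'n"
  assumes "psd S" "S \<noteq> 0"
  shows "trace S > 0"
proof -
  have tr: "trace S = (\<Sum>i\<in>UNIV. row i (mat 1) \<bullet> (S *v row i (mat 1)))"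
    using inner_conj_diag_quadratic[of "mat 1" "\<lambda>i. 1" S]
      row_transpose[of _ "mat 1 :: real^'n^'n"]
    by (simp add: conj_diag_one inner_eq_trace)
  obtain i where "row i (mat 1) \<bullet> (S *v row i (mat 1)) > 0"
    using psd_row_form_pos[OF assms, of "mat 1" "mat 1"] by auto
  then show ?thesis
    unfolding tr using assms(1) by (intro sum_pos2[of _ i]) (auto simp: psd_def)
qed

text \<open>
  With \<open>m\<close> the mean of the exponents \<open>d\<close> and \<open>\<rho>\<close> the norm of their deviation from it, the objective is at
  least \<open>\<tau> * exp (- m - \<rho>) + q * m + \<eta> * \<rho>\<^sup>2\<close>, where \<open>\<tau> = trace S\<close>.  Substituting \<open>v = - m - \<rho>\<close> turns
  \<open>q * m\<close> into \<open>- q * v - q * \<rho>\<close>; then \<open>\<tau> * exp v - q * v\<close> dominates \<open>\<bar>v\<bar>\<close>, and the quadratic term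
  dominates any multiple of \<open>\<rho>\<close>.
\<close>

lemma L_coercive_penalized:
  fixes S :: "real^'n^'n"
  assumes S: "psd S" "S \<noteq> 0" and eta: "\<eta> > 0"
  shows "\<exists>c. \<forall>A. pos_def A \<longrightarrow> norm (mat_log A) / real CARD('n) - c \<le> L S \<eta> A"
proof -
  let ?q = "real CARD('n)"
  define \<tau> where "\<tau> = trace S"
  have \<tau>: "\<tau> > 0" unfolding \<tau>_def by (rule psd_trace_pos[OF S])
  have q: "?q \<ge> 1" by (simp add: Suc_leI)
  define c where "c = (?q + 1)\<^sup>2 / (2 * \<tau>) + (?q + 2)\<^sup>2 / (4 * \<eta>)"
  show ?thesis
  proof (intro exI[of _ c] allI impI)
    fix A :: "real^'n^'n" assume "pos_def A"
    then obtain Q d where Q: "orthogonal_matrix Q" and A: "A = conj_diag Q (\<lambda>i. exp (d i))"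
      by (rule pos_def_spectral)
    define s where "s i = column i Q \<bullet> (S *v column i Q)" for i
    define m where "m = (\<Sum>i\<in>UNIV. d i) / ?q"
    define \<rho> where "\<rho> = L2_set (\<lambda>i. d i - m) UNIV"
    have s0: "s i \<ge> 0" for i using S by (simp add: s_def psd_def)
    have "(\<Sum>i\<in>UNIV. s i) = \<tau>"
      using inner_conj_diag_quadratic[of Q "\<lambda>i. 1" S] conj_diag_const[OF Q, of 1]
      by (simp add: s_def \<tau>_def inner_eq_trace)
    have dev: "d i - m \<le> \<rho>" for i
      unfolding \<rho>_def by (rule member_le_L2_set) auto
    have dev': "\<bar>d i - m\<bar> \<le> \<rho>" for i
      using member_le_L2_set[of UNIV i "\<lambda>i. \<bar>d i - m\<bar>"] by (simp add: \<rho>_def L2_set_def)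
    have \<rho>2: "(\<Sum>i\<in>UNIV. (d i)\<^sup>2) - (\<Sum>i\<in>UNIV. d i)\<^sup>2 / ?q = \<rho>\<^sup>2"
      unfolding sum_square_deviation \<rho>_def L2_set_def m_def by (simp add: sum_nonneg)
    have "\<tau> * exp (- m - \<rho>) = (\<Sum>i\<in>UNIV. exp (- m - \<rho>) * s i)"
      using \<open>sum s UNIV = \<tau>\<close> by (simp add: sum_distrib_left[symmetric])
    also have "\<dots> \<le> (\<Sum>i\<in>UNIV. exp (- d i) * s i)"
    proof (intro sum_mono mult_right_mono s0)
      fix i show "exp (- m - \<rho>) \<le> exp (- d i)" using dev[of i] by simp
    qed
    finally have T: "\<tau> * exp (- m - \<rho>) \<le> (\<Sum>i\<in>UNIV. exp (- d i) * s i)" .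
    have "(\<Sum>i\<in>UNIV. d i) = ?q * m" by (simp add: m_def)
    then have L: "L S \<eta> A = (\<Sum>i\<in>UNIV. exp (- d i) * s i) + ?q * m + \<eta> * \<rho>\<^sup>2"
      unfolding A L_spectral[OF Q] \<rho>2 s_def[symmetric] by simp
    have "\<eta> * \<rho>\<^sup>2 - (?q + 2) * \<rho> + (?q + 2)\<^sup>2 / (4 * \<eta>) = (2 * \<eta> * \<rho> - (?q + 2))\<^sup>2 / (4 * \<eta>)"
      using eta by (simp add: power2_diff field_simps power2_eq_square)
    also have "\<dots> \<ge> 0" using eta by simp
    finally have sq: "(?q + 2) * \<rho> - (?q + 2)\<^sup>2 / (4 * \<eta>) \<le> \<eta> * \<rho>\<^sup>2" by simp
    have "\<bar>m\<bar> + \<rho> - c \<le> \<bar>- m - \<rho>\<bar> + 2 * \<rho> - c" using dev'[of undefined] by linarith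
    also have "\<dots> \<le> \<tau> * exp (- m - \<rho>) - ?q * (- m - \<rho>) - ?q * \<rho> + \<eta> * \<rho>\<^sup>2"
      using exp_dominates_linear[OF \<tau> q, of "- m - \<rho>"] sq by (simp add: c_def algebra_simps)
    also have "\<dots> \<le> L S \<eta> A" unfolding L using T by (simp add: algebra_simps)
    finally have *: "\<bar>m\<bar> + \<rho> - c \<le> L S \<eta> A" .
    have "norm (mat_log A) \<le> (\<Sum>i\<in>UNIV. \<bar>d i\<bar>)"
      unfolding A norm_mat_log_spectral[OF Q] by (rule L2_set_le_sum_abs)
    also have "\<dots> \<le> (\<Sum>i\<in>(UNIV::'n set). \<bar>m\<bar> + \<rho>)"
    proof (rule sum_mono)
      fix i show "\<bar>d i\<bar> \<le> \<bar>m\<bar> + \<rho>" using dev'[of i] by linarith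
    qed
    finally have "norm (mat_log A) / ?q \<le> \<bar>m\<bar> + \<rho>" by (simp add: divide_le_eq mult.commute)
    then show "norm (mat_log A) / ?q - c \<le> L S \<eta> A" using * by linarith
  qed
qed

lemma L_coercive:
  fixes S :: "real^'n^'n"
  assumes S: "psd S" "S \<noteq> 0" and eta: "\<eta> \<ge> 0" "\<not> invertible S \<Longrightarrow> \<eta> > 0"
  obtains \<kappa> c where "\<kappa> > 0" "\<And>A. pos_def A \<Longrightarrow> \<kappa> * norm (mat_log A) - c \<le> L S \<eta> A"
proof (cases "invertible S")
  case True
  then show ?thesis using L_coercive_invertible[OF S(1) _ eta(1)] that[of 1] by auto
next
  case False
  then show ?thesis
    using L_coercive_penalized[OF S eta(2)] that[of "1 / real CARD('n)"] by auto
qed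

lemma g_coercive_linear_bound:
  fixes F :: "real^'n^'n \<Rightarrow> real"
  assumes "\<kappa> > 0" "\<And>A. pos_def A \<Longrightarrow> \<kappa> * norm (mat_log A) - c \<le> F A"
  shows "g_coercive F"
  unfolding g_coercive_def filterlim_at_top eventually_inf_principal eventually_filtercomap
proof
  fix Z
  have "Z \<le> F A" if "(Z + c) / \<kappa> \<le> norm (mat_log A)" "pos_def A" for A
    using that assms(2)[OF that(2)] assms(1) by (simp add: pos_divide_le_eq mult.commute)
  then show "\<exists>P. eventually P at_top \<and> (\<forall>A. P (norm (mat_log A)) \<longrightarrow> A \<in> {A. pos_def A} \<longrightarrow> Z \<le> F A)"
    by (intro exI[of _ "\<lambda>y. (Z + c) / \<kappa> \<le> y"]) (auto simp: eventually_ge_at_top)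
qed

lemma compact_orthogonal_matrices: "compact {Q :: real^'n^'n. orthogonal_matrix Q}"
proof (rule compact_eq_bounded_closed[THEN iffD2], rule conjI)
  have "norm Q \<le> sqrt (real CARD('n))" if "orthogonal_matrix Q" for Q :: "real^'n^'n"
  proof -
    have "Q \<bullet> Q = real CARD('n)"
      using that by (simp add: inner_eq_trace orthogonal_matrix_def trace_I)
    then show ?thesis by (simp add: norm_eq_sqrt_inner)
  qed
  then show "bounded {Q :: real^'n^'n. orthogonal_matrix Q}" unfolding bounded_iff by blast
  have "{Q :: real^'n^'n. orthogonal_matrix Q}
      = {Q. \<forall>i j. (\<Sum>k\<in>UNIV. Q $ k $ i * Q $ k $ j) = (if i = j then 1 else 0)}"
    by (simp add: orthogonal_matrix vec_eq_iff matrix_matrix_mult_def transpose_def mat_def)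
  also have "closed \<dots>"
    by (intro closed_Collect_all closed_Collect_eq continuous_intros)
  finally show "closed {Q :: real^'n^'n. orthogonal_matrix Q}" .
qed

text \<open>
  By the linear lower bound, matrices with large logarithm have values above the one at the identity.
  The others are parametrized by orthogonal matrices and a ball of exponents, a compact set; this
  makes the continuity of the matrix logarithm unnecessary.
\<close>

theorem L_minimizer_exists:
  fixes S :: "real^'n^'n"
  assumes \<kappa>: "\<kappa> > 0" and ge: "\<And>A. pos_def A \<Longrightarrow> \<kappa> * norm (mat_log A) - c \<le> L S \<eta> A"
  obtains A where "global_minimizer (L S \<eta>) A"
proof -
  define R where "R = max 0 ((L S \<eta> (mat 1) + c) / \<kappa>)"
  define X where "X p = conj_diag (fst p) (\<lambda>i. exp (snd p $ i))" for p :: "(real^'n^'n) \<times> (real^'n)"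
  let ?K = "{Q :: real^'n^'n. orthogonal_matrix Q} \<times> cball (0::real^'n) R"
  have "compact ?K" by (intro compact_Times compact_orthogonal_matrices compact_cball)
  moreover have idK: "(mat 1, 0) \<in> ?K" by (simp add: orthogonal_matrix_id R_def)
  then have "?K \<noteq> {}" by blast
  moreover have "continuous_on ?K (\<lambda>p. L S \<eta> (X p))"
  proof (rule continuous_on_eq)
    show "continuous_on ?K (\<lambda>p. (\<Sum>i\<in>UNIV. exp (- snd p $ i) *
        (\<Sum>a\<in>UNIV. fst p $ a $ i * (\<Sum>b\<in>UNIV. S $ a $ b * fst p $ b $ i)))
      + (\<Sum>i\<in>UNIV. snd p $ i)
      + \<eta> * ((\<Sum>i\<in>UNIV. (snd p $ i)\<^sup>2) - (\<Sum>i\<in>UNIV. snd p $ i)\<^sup>2 / real CARD('n)))"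
      by (intro continuous_intros) auto
  qed (auto simp: X_def L_spectral inner_vec_def column_def matrix_vector_mult_def)
  ultimately obtain p where p: "p \<in> ?K" and min: "\<And>r. r \<in> ?K \<Longrightarrow> L S \<eta> (X p) \<le> L S \<eta> (X r)"
    using continuous_attains_inf[of ?K "\<lambda>p. L S \<eta> (X p)"] by blast
  have "global_minimizer (L S \<eta>) (X p)"
    unfolding global_minimizer_def
  proof (intro conjI allI impI)
    show "pos_def (X p)"
      using p unfolding X_def by (intro pos_def_conj_diag_exp invertible_orthogonal) auto
    fix B :: "real^'n^'n" assume B: "pos_def B"
    then obtain Q d where Q: "orthogonal_matrix Q" and Beq: "B = conj_diag Q (\<lambda>i. exp (d i))"
      by (rule pos_def_spectral)
    show "L S \<eta> (X p) \<le> L S \<eta> B"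
    proof (cases "norm (mat_log B) \<le> R")
      case True
      have "norm (\<chi> i. d i) = norm (mat_log B)"
        unfolding Beq norm_mat_log_spectral[OF Q] by (simp add: norm_vec_def L2_set_def)
      then have "(Q, \<chi> i. d i) \<in> ?K" using Q True by simp
      from min[OF this] show ?thesis by (simp add: X_def Beq)
    next
      case False
      then have "(L S \<eta> (mat 1) + c) / \<kappa> < norm (mat_log B)" by (simp add: R_def)
      then have "L S \<eta> (mat 1) < L S \<eta> B"
        using \<kappa> ge[OF B] by (simp add: pos_divide_less_eq mult.commute)
      moreover have "X (mat 1, 0) = mat 1" by (simp add: X_def conj_diag_one)
      ultimately show ?thesis using min[OF idK] by simp
    qed
  qed
  then show ?thesis by (rule that)
qed

lemma pos_def_geodesic:
  assumes "pos_def A" "pos_def B"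
  shows "pos_def (geodesic A B t)"
proof -
  obtain G h where "invertible G" "geodesic A B t = conj_diag G (\<lambda>i. exp (t * h i))"
    using geodesic_conj_diag[OF assms] by metis
  then show ?thesis by (simp add: pos_def_conj_diag_exp)
qed

lemma global_minimizer_unique:
  assumes F: "strictly_g_convex F" and A: "global_minimizer F A" and B: "global_minimizer F B"
  shows "A = B"
proof (rule ccontr)
  assume "A \<noteq> B"
  let ?C = "geodesic A B (1/2)"
  have pd: "pos_def A" "pos_def B" using A B by (auto simp: global_minimizer_def)
  have "F ?C < (1 - 1/2) * F A + 1/2 * F B"
    using F[unfolded strictly_g_convex_def, rule_format, OF pd \<open>A \<noteq> B\<close>, of "1/2"] by simp
  moreover have "F A \<le> F ?C" "F B \<le> F ?C"
    using A B pos_def_geodesic[OF pd] by (auto simp: global_minimizer_def)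
  ultimately show False by simp
qed

section \<open>The gradient\<close>

lemma quadratic_remainder_bound:
  fixes f f' f'' :: "real \<Rightarrow> real"
  assumes f: "\<And>x. x \<ge> m \<Longrightarrow> (f has_real_derivative f' x) (at x)"
    and f': "\<And>x. x \<ge> m \<Longrightarrow> (f' has_real_derivative f'' x) (at x)"
    and K: "\<And>x. x \<ge> m \<Longrightarrow> \<bar>f'' x\<bar> \<le> K"
    and de: "d \<ge> m" "e \<ge> m"
  shows "\<bar>f e - f d - f' d * (e - d)\<bar> \<le> K * (e - d)\<^sup>2"
proof -
  let ?I = "closed_segment d e"
  have I: "x \<ge> m" if "x \<in> ?I" for x using that de by (auto simp: closed_segment_eq_real_ivl split: if_splits)
  have K0: "K \<ge> 0" using K[OF de(1)] by linarith
  have f'_lip: "\<bar>f' x - f' d\<bar> \<le> K * \<bar>e - d\<bar>" if x: "x \<in> ?I" for x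
  proof -
    have "norm (f' x - f' d) \<le> K * norm (x - d)"
      by (rule field_differentiable_bound[of ?I])
        (use I f' K x in \<open>auto intro: DERIV_subset\<close>)
    also have "\<dots> \<le> K * \<bar>e - d\<bar>"
      using x K0 by (intro mult_left_mono) (auto simp: closed_segment_eq_real_ivl split: if_splits)
    finally show ?thesis by simp
  qed
  have "norm ((f e - f' d * e) - (f d - f' d * d)) \<le> (K * \<bar>e - d\<bar>) * norm (e - d)"
  proof (rule field_differentiable_bound[of ?I])
    fix x assume x: "x \<in> ?I"
    show "((\<lambda>x. f x - f' d * x) has_field_derivative (f' x - f' d)) (at x within ?I)"
      using DERIV_subset[OF f[OF I[OF x]], of ?I] by (auto intro!: derivative_eq_intros)
    show "norm (f' x - f' d) \<le> K * \<bar>e - d\<bar>" using f'_lip[OF x] by simp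
  qed auto
  then show ?thesis by (simp add: power2_eq_square algebra_simps abs_mult_self_eq)
qed

lemma has_derivative_quadratic_remainder:
  fixes f :: "'a::real_normed_vector \<Rightarrow> real"
  assumes T: "bounded_linear T" and \<delta>: "\<delta> > 0"
    and rem: "\<And>y. y \<in> X \<Longrightarrow> norm (y - x) < \<delta> \<Longrightarrow> \<bar>f y - f x - T (y - x)\<bar> \<le> K * (norm (y - x))\<^sup>2"
  shows "(f has_derivative T) (at x within X)"
  unfolding has_derivative_within_alt
proof (intro conjI T allI impI)
  fix e :: real assume e: "e > 0"
  define K' where "K' = \<bar>K\<bar> + 1"
  have K': "K \<le> K'" "K' > 0" by (auto simp: K'_def)
  show "\<exists>d>0. \<forall>y\<in>X. norm (y - x) < d \<longrightarrow> norm (f y - f x - T (y - x)) \<le> e * norm (y - x)"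
  proof (intro exI[of _ "min \<delta> (e / K')"] conjI ballI impI)
    show "0 < min \<delta> (e / K')" using \<delta> e K' by simp
    fix y assume y: "y \<in> X" "norm (y - x) < min \<delta> (e / K')"
    have "\<bar>f y - f x - T (y - x)\<bar> \<le> K * (norm (y - x))\<^sup>2" using rem y by simp
    also have "\<dots> \<le> K' * (norm (y - x))\<^sup>2" using K' by (intro mult_right_mono) auto
    also have "\<dots> = (K' * norm (y - x)) * norm (y - x)" by (simp add: power2_eq_square)
    also have "\<dots> \<le> e * norm (y - x)"
    proof (rule mult_right_mono)
      show "K' * norm (y - x) \<le> e" using y K' by (simp add: pos_less_divide_eq mult.commute less_imp_le)
    qed simp
    finally show "norm (f y - f x - T (y - x)) \<le> e * norm (y - x)" by simp
  qed
qed

text \<open>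
  An eigenvalue of the second matrix far below all eigenvalues of the first would alone make the
  Frobenius distance large, because the overlaps in its column sum to one.
\<close>

lemma eigenvalue_lower_bound:
  assumes Q: "orthogonal_matrix Q" and P: "orthogonal_matrix P"
    and a: "\<And>i. 2 * m \<le> a i" and m: "m > 0"
    and close: "norm (conj_diag P b - conj_diag Q a) < m"
  shows "m \<le> b j"
proof (rule ccontr)
  assume bj: "\<not> m \<le> b j"
  have "m\<^sup>2 = (\<Sum>i\<in>UNIV. overlap Q P i j * m\<^sup>2)"
    using sum_overlap_col[OF Q P, of j] by (simp add: sum_distrib_right[symmetric])
  also have "\<dots> \<le> (\<Sum>i\<in>UNIV. overlap Q P i j * (a i - b j)\<^sup>2)"
  proof (intro sum_mono mult_left_mono overlap_nonneg power_mono)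
    fix i show "m \<le> a i - b j" using a[of i] bj by linarith
  qed (use m in simp)
  also have "\<dots> \<le> (\<Sum>j\<in>UNIV. \<Sum>i\<in>UNIV. overlap Q P i j * (a i - b j)\<^sup>2)"
    by (rule member_le_sum) (auto intro!: sum_nonneg mult_nonneg_nonneg overlap_nonneg)
  also have "\<dots> = (norm (conj_diag Q a - conj_diag P b))\<^sup>2"
    by (subst sum.swap) (simp add: norm_diff_conj_diag[OF Q P])
  also have "\<dots> < m\<^sup>2"
    using close by (intro power_strict_mono) (auto simp: norm_minus_commute)
  finally show False by simp
qed

lemma pos_def_spectral_bound:
  fixes A :: "real^'n^'n"
  assumes "pos_def A"
  obtains Q a m where "orthogonal_matrix Q" "A = conj_diag Q a" "m > 0" "\<And>i. 2 * m \<le> a i"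
proof -
  obtain Q d where Q: "orthogonal_matrix Q" and A: "A = conj_diag Q (\<lambda>i. exp (d i))"
    using pos_def_spectral[OF assms] .
  define m where "m = Min (range (\<lambda>i. exp (d i))) / 2"
  have "m > 0" by (simp add: m_def)
  moreover have "2 * m \<le> exp (d i)" for i by (simp add: m_def)
  ultimately show ?thesis using that[OF Q A] by blast
qed

lemma pos_def_near:
  fixes A :: "real^'n^'n"
  assumes "pos_def A"
  obtains \<delta> where "\<delta> > 0" "\<And>B. transpose B = B \<Longrightarrow> norm (B - A) < \<delta> \<Longrightarrow> pos_def B"
proof -
  obtain Q a m where Q: "orthogonal_matrix Q" and A: "A = conj_diag Q a"
    and m: "m > 0" "\<And>i. 2 * m \<le> a i"
    using pos_def_spectral_bound[OF assms] by blast
  have "pos_def B" if B: "transpose B = B" "norm (B - A) < m" for B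
  proof -
    obtain P b where P: "orthogonal_matrix P" and Beq: "B = conj_diag P b"
      using spectral_theorem[OF B(1)] .
    have "m \<le> b j" for j
      using eigenvalue_lower_bound[OF Q P m(2,1)] B(2) by (simp add: A Beq)
    then have "b j > 0" for j using m(1) less_le_trans by blast
    then show ?thesis unfolding Beq by (intro pos_def_conj_diag invertible_orthogonal P)
  qed
  then show ?thesis using that m(1) by blast
qed

lemma trace_conj_diag: "orthogonal_matrix Q \<Longrightarrow> trace (conj_diag Q a) = (\<Sum>i\<in>UNIV. a i)"
  using inner_conj_diag_same[of Q a "\<lambda>i. 1"] conj_diag_const[of Q 1]
  by (simp add: inner_eq_trace transpose_conj_diag)

lemma mat_fun_conj_diag:
  "orthogonal_matrix Q \<Longrightarrow> mat_fun f (conj_diag Q a) = conj_diag Q (\<lambda>i. f (a i))"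
  using mat_fun_eq[of Q f a] by (simp add: conj_diag_def)

text \<open>
  The remainder of the first-order expansion of \<open>trace (mat_fun f X)\<close> is the overlap-weighted sum of the
  scalar remainders of \<open>f\<close>, and the same weights express the squared Frobenius distance.  A quadratic
  bound for the scalar remainder is therefore a quadratic bound for the matrix one.
\<close>

theorem has_derivative_trace_mat_fun:
  fixes A :: "real^'n^'n"
  assumes A: "pos_def A"
    and f: "\<And>x. x > 0 \<Longrightarrow> (f has_real_derivative f' x) (at x)"
    and f': "\<And>x. x > 0 \<Longrightarrow> (f' has_real_derivative f'' x) (at x)"
    and bd: "\<And>m. m > 0 \<Longrightarrow> \<exists>K. \<forall>x\<ge>m. \<bar>f'' x\<bar> \<le> K"
  shows "((\<lambda>X. trace (mat_fun f X)) has_derivative (\<lambda>H. mat_fun f' A \<bullet> H)) (at A within {X. pos_def X})"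
proof -
  obtain Q a m where Q: "orthogonal_matrix Q" and Aeq: "A = conj_diag Q a"
    and m: "m > 0" "\<And>i. 2 * m \<le> a i"
    using pos_def_spectral_bound[OF A] by blast
  obtain K where K: "\<And>x. x \<ge> m \<Longrightarrow> \<bar>f'' x\<bar> \<le> K" using bd[OF m(1)] by blast
  show ?thesis
  proof (rule has_derivative_quadratic_remainder[OF _ m(1)])
    show "bounded_linear (\<lambda>H. mat_fun f' A \<bullet> H)" by (rule bounded_linear_inner_right)
    fix B :: "real^'n^'n" assume "B \<in> {X. pos_def X}" and close: "norm (B - A) < m"
    then have "transpose B = B" by (simp add: pos_def_def)
    then obtain P b where P: "orthogonal_matrix P" and Beq: "B = conj_diag P b"
      by (rule spectral_theorem)
    have b: "m \<le> b j" for j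
      using eigenvalue_lower_bound[OF Q P m(2,1)] close by (simp add: Aeq Beq)
    have a: "m \<le> a i" for i using m(1) m(2)[of i] by linarith
    let ?w = "overlap Q P"
    have fB: "trace (mat_fun f B) = (\<Sum>i\<in>UNIV. \<Sum>j\<in>UNIV. ?w i j * f (b j))"
      by (simp only: Beq mat_fun_conj_diag[OF P] trace_conj_diag[OF P] sum_overlap_right[OF Q P])
    have fA: "trace (mat_fun f A) = (\<Sum>i\<in>UNIV. \<Sum>j\<in>UNIV. ?w i j * f (a i))"
      by (simp only: Aeq mat_fun_conj_diag[OF Q] trace_conj_diag[OF Q] sum_overlap_left[OF Q P])
    have f'B: "mat_fun f' A \<bullet> B = (\<Sum>i\<in>UNIV. \<Sum>j\<in>UNIV. ?w i j * (f' (a i) * b j))"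
      by (simp only: Aeq Beq mat_fun_conj_diag[OF Q] inner_conj_diag)
    have f'A: "mat_fun f' A \<bullet> A = (\<Sum>i\<in>UNIV. \<Sum>j\<in>UNIV. ?w i j * (f' (a i) * a i))"
      by (simp only: Aeq mat_fun_conj_diag[OF Q] inner_conj_diag_same[OF Q] sum_overlap_left[OF Q P])
    have "trace (mat_fun f B) - trace (mat_fun f A) - mat_fun f' A \<bullet> (B - A)
      = (\<Sum>i\<in>UNIV. \<Sum>j\<in>UNIV. ?w i j * f (b j)) - (\<Sum>i\<in>UNIV. \<Sum>j\<in>UNIV. ?w i j * f (a i))
        - ((\<Sum>i\<in>UNIV. \<Sum>j\<in>UNIV. ?w i j * (f' (a i) * b j))
           - (\<Sum>i\<in>UNIV. \<Sum>j\<in>UNIV. ?w i j * (f' (a i) * a i)))"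
      by (simp only: inner_diff_right fB fA f'B f'A)
    also have "\<dots> = (\<Sum>i\<in>UNIV. \<Sum>j\<in>UNIV. ?w i j * (f (b j) - f (a i) - f' (a i) * (b j - a i)))"
      unfolding sum_subtractf[symmetric] by (simp add: algebra_simps)
    finally have eq: "trace (mat_fun f B) - trace (mat_fun f A) - mat_fun f' A \<bullet> (B - A)
      = (\<Sum>i\<in>UNIV. \<Sum>j\<in>UNIV. ?w i j * (f (b j) - f (a i) - f' (a i) * (b j - a i)))" .
    have term_le: "\<bar>?w i j * (f (b j) - f (a i) - f' (a i) * (b j - a i))\<bar> \<le> ?w i j * (K * (b j - a i)\<^sup>2)" for i j
    proof -
      have "\<bar>f (b j) - f (a i) - f' (a i) * (b j - a i)\<bar> \<le> K * (b j - a i)\<^sup>2"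
        using m(1) by (intro quadratic_remainder_bound[of m f f' f''] f f' K a b) auto
      then show ?thesis by (simp add: abs_mult overlap_nonneg mult_left_mono)
    qed
    have "\<bar>trace (mat_fun f B) - trace (mat_fun f A) - mat_fun f' A \<bullet> (B - A)\<bar>
      \<le> (\<Sum>i\<in>UNIV. \<Sum>j\<in>UNIV. ?w i j * (K * (b j - a i)\<^sup>2))"
      unfolding eq by (intro order_trans[OF sum_abs] sum_mono term_le)
    also have "\<dots> = K * (norm (A - B))\<^sup>2"
      unfolding Aeq Beq norm_diff_conj_diag[OF Q P]
      by (simp add: sum_distrib_left power2_commute[of "b _"] mult_ac)
    finally show "\<bar>trace (mat_fun f B) - trace (mat_fun f A) - mat_fun f' A \<bullet> (B - A)\<bar>
      \<le> K * (norm (B - A))\<^sup>2"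
      by (simp add: norm_minus_commute)
  qed
qed

lemma bounded_bilinear_matrix_mult:
  "bounded_bilinear ((**) :: real^'n^'n \<Rightarrow> real^'n^'n \<Rightarrow> real^'n^'n)"
  unfolding bilinear_conv_bounded_bilinear[symmetric] bilinear_def linear_iff
  by (simp add: matrix_add_ldistrib vec_eq_iff matrix_matrix_mult_def sum.distrib algebra_simps
      sum_distrib_left)

lemma matrix_mult_norm_bound:
  obtains C where "C > 0" "\<And>(X :: real^'n^'n) (Y :: real^'n^'n). norm (X ** Y) \<le> norm X * norm Y * C"
proof -
  have "\<exists>C>0. \<forall>(X :: real^'n^'n) (Y :: real^'n^'n). norm (X ** Y) \<le> norm X * norm Y * C"
    by (rule bounded_bilinear.pos_bounded[OF bounded_bilinear_matrix_mult])
  then show ?thesis using that by auto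
qed

lemma matrix_inv_inverse:
  fixes A :: "real^'n^'n"
  assumes "pos_def A"
  shows "matrix_inv A ** A = mat 1" "A ** matrix_inv A = mat 1" "transpose (matrix_inv A) = matrix_inv A"
proof -
  obtain Q d where Q: "orthogonal_matrix Q" and A: "A = conj_diag Q (\<lambda>i. exp (d i))"
    using pos_def_spectral[OF assms] .
  show "matrix_inv A ** A = mat 1"
    unfolding A matrix_inv_spectral[OF Q] conj_diag_mult[OF Q]
    using conj_diag_const[OF Q, of 1] by (simp add: mult_exp_exp)
  then show "A ** matrix_inv A = mat 1" by (rule matrix_left_right_inverse[THEN iffD1])
  show "transpose (matrix_inv A) = matrix_inv A"
    unfolding A matrix_inv_spectral[OF Q] by (rule transpose_conj_diag)
qed

text \<open>
  The function depends on the eigenvectors too, so it is not a trace of a matrix function; the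
  resolvent identity takes the place of the overlaps.
\<close>

lemma has_derivative_trace_inv_mult:
  fixes A S :: "real^'n^'n"
  assumes A: "pos_def A" and S: "transpose S = S"
  shows "((\<lambda>X. trace (matrix_inv X ** S)) has_derivative
    (\<lambda>H. - (matrix_inv A ** S ** matrix_inv A) \<bullet> H)) (at A within {X. pos_def X})"
proof -
  obtain Q a m where Q: "orthogonal_matrix Q" and Aeq: "A = conj_diag Q a"
    and m: "m > 0" "\<And>i. 2 * m \<le> a i"
    using pos_def_spectral_bound[OF A] by blast
  obtain C where C: "C > 0" "\<And>(X :: real^'n^'n) (Y :: real^'n^'n). norm (X ** Y) \<le> norm X * norm Y * C"
    using matrix_mult_norm_bound[where 'n = 'n] by metis
  let ?I = "matrix_inv A"
  define M where "M = sqrt (real CARD('n) * (1 / m)\<^sup>2)"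
  show ?thesis
  proof (rule has_derivative_quadratic_remainder[OF _ m(1)])
    show "bounded_linear (\<lambda>H. - (?I ** S ** ?I) \<bullet> H)" by (rule bounded_linear_inner_right)
    fix B :: "real^'n^'n" assume "B \<in> {X. pos_def X}" and close: "norm (B - A) < m"
    then have B: "pos_def B" by simp
    then have "transpose B = B" by (simp add: pos_def_def)
    then obtain P b where P: "orthogonal_matrix P" and Beq: "B = conj_diag P b"
      by (rule spectral_theorem)
    have b: "m \<le> b j" for j
      using eigenvalue_lower_bound[OF Q P m(2,1)] close by (simp add: Aeq Beq)
    then have b0: "b j \<noteq> 0" for j using m(1) by (metis less_le_not_le)
    let ?J = "matrix_inv B" and ?H = "B - A"
    have J: "norm ?J \<le> M"
    proof -
      have "?J = conj_diag P (\<lambda>i. inverse (b i))"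
        unfolding Beq using matrix_inv_conj_diag[of "transpose P" P b] P b0
        by (simp add: orthogonal_matrix_def)
      then have "(norm ?J)\<^sup>2 = (\<Sum>i\<in>UNIV. (inverse (b i))\<^sup>2)" by (simp add: norm_conj_diag[OF P])
      also have "\<dots> \<le> (\<Sum>i\<in>(UNIV::'n set). (1 / m)\<^sup>2)"
      proof (intro sum_mono power_mono)
        fix i show "inverse (b i) \<le> 1 / m"
          using b[of i] m(1) by (simp add: inverse_eq_divide frac_le)
        show "0 \<le> inverse (b i)" using b[of i] m(1) by simp
      qed
      finally show ?thesis unfolding M_def by (intro real_le_rsqrt) simp
    qed
    have AB: "?J - ?I = - (?I ** ?H ** ?J)"
    proof -
      have "?I ** ?H ** ?J = ?I ** (B ** ?J) - (?I ** A) ** ?J"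
        by (simp add: bounded_bilinear.diff_left[OF bounded_bilinear_matrix_mult]
            bounded_bilinear.diff_right[OF bounded_bilinear_matrix_mult] matrix_mul_assoc)
      then show ?thesis by (simp add: matrix_inv_inverse[OF A] matrix_inv_inverse[OF B])
    qed
    have res: "?J - ?I + ?I ** ?H ** ?I = ?I ** ?H ** (?I ** ?H ** ?J)"
    proof -
      have "?I ** ?H ** ?J = ?I - ?J" using arg_cong[OF AB, of uminus] by simp
      then have "?I ** ?H ** (?I ** ?H ** ?J) = ?I ** ?H ** (?I - ?J)" by (simp only:)
      also have "\<dots> = ?I ** ?H ** ?I - ?I ** ?H ** ?J"
        by (rule bounded_bilinear.diff_right[OF bounded_bilinear_matrix_mult])
      finally show ?thesis unfolding AB by simp
    qed
    have lin: "(?I ** S ** ?I) \<bullet> ?H = (?I ** ?H ** ?I) \<bullet> S"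
    proof -
      have tH: "transpose ?H = ?H"
        using A B by (simp add: pos_def_def transpose_def vec_eq_iff)
      have "(?I ** S ** ?I) \<bullet> ?H = trace ((?I ** S) ** (?I ** ?H))"
        by (simp add: inner_eq_trace matrix_transpose_mul matrix_inv_inverse[OF A] S matrix_mul_assoc)
      also have "\<dots> = trace ((?I ** ?H ** ?I) ** S)"
        by (subst trace_mul_sym) (simp add: matrix_mul_assoc)
      also have "\<dots> = (?I ** ?H ** ?I) \<bullet> S"
        by (simp add: inner_eq_trace matrix_transpose_mul matrix_inv_inverse[OF A] tH matrix_mul_assoc)
      finally show ?thesis .
    qed
    have tr: "trace (matrix_inv X ** S) = matrix_inv X \<bullet> S" if "pos_def X" for X
      by (simp add: inner_eq_trace matrix_inv_inverse[OF that])
    have "trace (?J ** S) - trace (?I ** S) - (- (?I ** S ** ?I) \<bullet> ?H)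
      = (?J - ?I + ?I ** ?H ** ?I) \<bullet> S"
      using lin by (simp add: tr A B inner_diff_left inner_add_left)
    also have "\<bar>\<dots>\<bar> \<le> norm (?I ** ?H ** (?I ** ?H ** ?J)) * norm S"
      unfolding res by (rule Cauchy_Schwarz_ineq2)
    also have "\<dots> \<le> (norm ?I * norm ?H * C * (norm ?I * norm ?H * C * M * C) * C) * norm S"
    proof (rule mult_right_mono)
      have IH: "norm (?I ** ?H) \<le> norm ?I * norm ?H * C" by (rule C(2))
      have IHC: "0 \<le> norm ?I * norm ?H * C" using C(1) by simp
      have "norm (?I ** ?H ** ?J) \<le> norm (?I ** ?H) * norm ?J * C" by (rule C(2))
      also have "\<dots> \<le> norm ?I * norm ?H * C * M * C"
        using C(1) by (intro mult_right_mono mult_mono IH J IHC) auto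
      finally have IHJ: "norm (?I ** ?H ** ?J) \<le> norm ?I * norm ?H * C * M * C" .
      have "norm (?I ** ?H ** (?I ** ?H ** ?J)) \<le> norm (?I ** ?H) * norm (?I ** ?H ** ?J) * C"
        by (rule C(2))
      also have "\<dots> \<le> norm ?I * norm ?H * C * (norm ?I * norm ?H * C * M * C) * C"
        using C(1) by (intro mult_right_mono mult_mono IH IHJ IHC) auto
      finally show "norm (?I ** ?H ** (?I ** ?H ** ?J))
        \<le> norm ?I * norm ?H * C * (norm ?I * norm ?H * C * M * C) * C" .
    qed simp
    also have "\<dots> = ((norm ?I)\<^sup>2 * C * C * C * C * M * norm S) * (norm ?H)\<^sup>2"
      by (simp add: power2_eq_square)
    finally show "\<bar>trace (?J ** S) - trace (?I ** S) - (- (?I ** S ** ?I) \<bullet> ?H)\<bar>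
      \<le> ((norm ?I)\<^sup>2 * C * C * C * C * M * norm S) * (norm ?H)\<^sup>2" .
  qed
qed

lemma has_derivative_trace_ln:
  assumes "pos_def A"
  shows "((\<lambda>X. trace (mat_fun ln X)) has_derivative (\<lambda>H. mat_fun inverse A \<bullet> H)) (at A within {X. pos_def X})"
proof (rule has_derivative_trace_mat_fun[OF assms, where f'' = "\<lambda>x. - (inverse x)\<^sup>2"])
  fix x :: real assume "x > 0"
  then show "(ln has_real_derivative inverse x) (at x)"
    by (auto intro!: derivative_eq_intros simp: inverse_eq_divide)
  show "(inverse has_real_derivative - (inverse x)\<^sup>2) (at x)"
    using \<open>x > 0\<close> by (auto intro!: derivative_eq_intros simp: power2_eq_square)
next
  fix m :: real assume m: "m > 0"
  have "\<bar>- (inverse x)\<^sup>2\<bar> \<le> (inverse m)\<^sup>2" if "x \<ge> m" for x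
    using that m by (simp add: power_mono)
  then show "\<exists>K. \<forall>x\<ge>m. \<bar>- (inverse x)\<^sup>2\<bar> \<le> K" by blast
qed

lemma has_derivative_trace_ln_squared:
  assumes "pos_def A"
  shows "((\<lambda>X. trace (mat_fun (\<lambda>x. (ln x)\<^sup>2) X)) has_derivative
    (\<lambda>H. mat_fun (\<lambda>x. 2 * ln x / x) A \<bullet> H)) (at A within {X. pos_def X})"
proof (rule has_derivative_trace_mat_fun[OF assms, where f'' = "\<lambda>x. 2 * (1 - ln x) / x\<^sup>2"])
  fix x :: real assume x: "x > 0"
  then show "((\<lambda>x. (ln x)\<^sup>2) has_real_derivative 2 * ln x / x) (at x)"
    by (auto intro!: derivative_eq_intros)
  show "((\<lambda>x. 2 * ln x / x) has_real_derivative 2 * (1 - ln x) / x\<^sup>2) (at x)"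
    using x by (auto intro!: derivative_eq_intros simp: power2_eq_square divide_simps)
next
  fix m :: real assume m: "m > 0"
  have "\<bar>2 * (1 - ln x) / x\<^sup>2\<bar> \<le> 2 * (1 + 1 / m) / m\<^sup>2 + 2 / m" if x: "x \<ge> m" for x
  proof -
    have x0: "x > 0" using x m by simp
    have "ln x \<le> x" using ln_bound[OF x0] .
    moreover have "- ln x \<le> 1 / m"
    proof -
      have "- ln x = ln (1 / x)" using x0 by (simp add: ln_div)
      also have "\<dots> \<le> 1 / x" using x0 by (intro ln_bound) simp
      also have "\<dots> \<le> 1 / m" using x m by (simp add: frac_le)
      finally show ?thesis .
    qed
    ultimately have "\<bar>1 - ln x\<bar> \<le> (1 + 1 / m) + x"
      using m x0 by (simp add: abs_le_iff) (smt (verit) divide_pos_pos)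
    then have "\<bar>2 * (1 - ln x) / x\<^sup>2\<bar> \<le> 2 * ((1 + 1 / m) + x) / x\<^sup>2"
      by (simp add: abs_mult divide_right_mono)
    also have "\<dots> = 2 * (1 + 1 / m) / x\<^sup>2 + 2 / x"
      using x0 by (simp add: add_divide_distrib power2_eq_square distrib_left)
    also have "\<dots> \<le> 2 * (1 + 1 / m) / m\<^sup>2 + 2 / m"
      using x m by (intro add_mono frac_le power_mono) auto
    finally show ?thesis .
  qed
  then show "\<exists>K. \<forall>x\<ge>m. \<bar>2 * (1 - ln x) / x\<^sup>2\<bar> \<le> K" by blast
qed

lemma L_trace_mat_fun:
  fixes A :: "real^'n^'n"
  assumes "pos_def A"
  shows "L S \<eta> A = trace (matrix_inv A ** S) + trace (mat_fun ln A)
    + \<eta> * (trace (mat_fun (\<lambda>x. (ln x)\<^sup>2) A) - (trace (mat_fun ln A))\<^sup>2 / real CARD('n))"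
proof -
  obtain Q d where Q: "orthogonal_matrix Q" and A: "A = conj_diag Q (\<lambda>i. exp (d i))"
    using pos_def_spectral[OF assms] .
  have "ln (det A) = trace (mat_fun ln A)"
    using ln_det_conj_diag[OF invertible_orthogonal[OF Q]] det_orthogonal_squared[OF Q]
    by (simp add: A mat_fun_conj_diag Q trace_conj_diag)
  moreover have "Pi_Rs A = trace (mat_fun (\<lambda>x. (ln x)\<^sup>2) A) - (trace (mat_fun ln A))\<^sup>2 / real CARD('n)"
    by (simp add: A Pi_Rs_spectral[OF Q] mat_fun_conj_diag Q trace_conj_diag)
  ultimately show ?thesis by (simp add: L_def)
qed

theorem has_gradient_L:
  fixes A S :: "real^'n^'n"
  assumes A: "pos_def A" and S: "transpose S = S"
  obtains W where "has_gradient (L S \<eta>) W A"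
proof -
  let ?q = "real CARD('n)"
  define W where "W = - (matrix_inv A ** S ** matrix_inv A) + mat_fun inverse A
    + \<eta> *\<^sub>R (mat_fun (\<lambda>x. 2 * ln x / x) A - (2 * trace (mat_fun ln A) / ?q) *\<^sub>R mat_fun inverse A)"
  let ?t = "\<lambda>X. trace (mat_fun ln X)"
  note ln = has_derivative_trace_ln[OF A]
  note pen = has_derivative_diff[OF has_derivative_trace_ln_squared[OF A]
      has_derivative_mult_left[OF has_derivative_mult[OF ln ln], of "1 / ?q"]]
  have "((\<lambda>X. trace (matrix_inv X ** S) + ?t X
      + \<eta> * (trace (mat_fun (\<lambda>x. (ln x)\<^sup>2) X) - ?t X * ?t X * (1 / ?q))) has_derivative
      (\<lambda>H. W \<bullet> H)) (at A within {X. pos_def X})"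
    by (rule has_derivative_eq_rhs[OF has_derivative_add[OF has_derivative_add[OF
          has_derivative_trace_inv_mult[OF A S] ln] has_derivative_mult_right[OF pen, of \<eta>]]])
      (simp add: W_def fun_eq_iff inner_add_left inner_diff_left field_simps)
  then have "(L S \<eta> has_derivative (\<lambda>H. W \<bullet> H)) (at A within {X. pos_def X})"
    by (rule has_derivative_transform[rotated 2])
      (use A in \<open>auto simp: L_trace_mat_fun power2_eq_square\<close>)
  moreover have "transpose W = W"
  proof -
    obtain Q d where Q: "orthogonal_matrix Q" and Aeq: "A = conj_diag Q (\<lambda>i. exp (d i))"
      using pos_def_spectral[OF A] .
    have "transpose (mat_fun f A) = mat_fun f A" for f
      by (simp add: Aeq mat_fun_conj_diag[OF Q] transpose_conj_diag)
    moreover have "transpose (matrix_inv A ** S ** matrix_inv A) = matrix_inv A ** S ** matrix_inv A"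
      by (simp add: matrix_transpose_mul matrix_inv_inverse[OF A] S matrix_mul_assoc)
    moreover have "transpose (X + Y) = transpose X + transpose Y" "transpose (X - Y) = transpose X - transpose Y"
      "transpose (- X) = - transpose X" for X Y :: "real^'n^'n"
      by (simp_all add: transpose_def vec_eq_iff)
    ultimately show ?thesis by (simp add: W_def transpose_scalar)
  qed
  ultimately show ?thesis using that by (simp add: has_gradient_def)
qed

section \<open>Critical points and minimizers\<close>

text \<open>
  Since \<open>W\<close> is symmetric, a short step from \<open>A\<close> in the direction \<open>- W\<close> stays positive definite, and it
  would decrease \<open>F\<close> if \<open>W\<close> were nonzero.
\<close>

lemma global_minimizer_gradient_zero:
  fixes A :: "real^'n^'n"
  assumes min: "global_minimizer F A" and W: "has_gradient F W A"
  shows "W = 0"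
proof (rule ccontr)
  assume "W \<noteq> 0"
  define e where "e = norm W / 2"
  have e: "e > 0" using \<open>W \<noteq> 0\<close> by (simp add: e_def)
  have A: "pos_def A" and tA: "transpose A = A" using min by (auto simp: global_minimizer_def pos_def_def)
  have tW: "transpose W = W" and der: "(F has_derivative (\<lambda>H. W \<bullet> H)) (at A within {A. pos_def A})"
    using W by (auto simp: has_gradient_def)
  obtain d where d: "d > 0" and
    lin: "\<And>y. pos_def y \<Longrightarrow> norm (y - A) < d \<Longrightarrow> norm (F y - F A - W \<bullet> (y - A)) \<le> e * norm (y - A)"
    using der e unfolding has_derivative_within_alt by blast
  obtain \<delta> where \<delta>: "\<delta> > 0" "\<And>B. transpose B = B \<Longrightarrow> norm (B - A) < \<delta> \<Longrightarrow> pos_def B"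
    using pos_def_near[OF A] by blast
  define t where "t = min d \<delta> / (2 * norm W)"
  have t: "t > 0" using d \<delta> \<open>W \<noteq> 0\<close> by (simp add: t_def)
  define B where "B = A - t *\<^sub>R W"
  have "norm (B - A) = t * norm W" using t by (simp add: B_def)
  also have "\<dots> = min d \<delta> / 2" using \<open>W \<noteq> 0\<close> by (simp add: t_def)
  finally have nB: "norm (B - A) < d" "norm (B - A) < \<delta>" "norm (B - A) = t * norm W"
    using d \<delta> \<open>norm (B - A) = t * norm W\<close> by auto
  have "transpose B = B"
  proof -
    have "transpose B = transpose A - t *\<^sub>R transpose W" by (simp add: B_def transpose_def vec_eq_iff)
    then show ?thesis by (simp add: tA tW B_def)
  qed
  then have B: "pos_def B" using \<delta>(2) nB by blast
  have "F A \<le> F B" using min B by (simp add: global_minimizer_def)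
  moreover have "W \<bullet> (B - A) = - (t * (norm W)\<^sup>2)" by (simp add: B_def power2_norm_eq_inner)
  ultimately have "t * (norm W)\<^sup>2 \<le> norm (F B - F A - W \<bullet> (B - A))" by simp
  also have "\<dots> \<le> e * (t * norm W)" using lin[OF B nB(1)] nB(3) by simp
  also have "\<dots> = t * (norm W)\<^sup>2 / 2" by (simp add: e_def power2_eq_square)
  finally show False using t \<open>W \<noteq> 0\<close> by simp
qed

lemma geodesic_lipschitz_at_0:
  fixes A B :: "real^'n^'n"
  assumes "pos_def A" "pos_def B"
  obtains C where "C > 0" "\<And>t. 0 \<le> t \<Longrightarrow> t \<le> 1 \<Longrightarrow> norm (geodesic A B t - A) \<le> C * t"
proof -
  obtain G h where A: "A = conj_diag G (\<lambda>i. 1)"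
    and geo: "\<And>t. geodesic A B t = conj_diag G (\<lambda>i. exp (t * h i))"
    using geodesic_conj_diag[OF assms] by metis
  obtain C where C: "C > 0" "\<And>(X :: real^'n^'n) (Y :: real^'n^'n). norm (X ** Y) \<le> norm X * norm Y * C"
    using matrix_mult_norm_bound[where 'n = 'n] by metis
  define k where "k = (\<Sum>i\<in>UNIV. \<bar>h i\<bar> * exp \<bar>h i\<bar>)"
  have k: "k \<ge> 0" by (simp add: k_def sum_nonneg)
  define C' where "C' = norm G * k * C * norm (transpose G) * C"
  have C': "C' \<ge> 0" using C k by (simp add: C'_def)
  have exp1: "\<bar>exp (t * y) - 1\<bar> \<le> t * (\<bar>y\<bar> * exp \<bar>y\<bar>)" if t: "0 \<le> t" "t \<le> 1" for t y :: real
  proof -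
    let ?x = "t * y"
    have "\<bar>?x\<bar> = t * \<bar>y\<bar>" using t by (simp add: abs_mult)
    also have "\<dots> \<le> 1 * \<bar>y\<bar>" using t by (intro mult_right_mono) auto
    finally have xy: "\<bar>?x\<bar> \<le> \<bar>y\<bar>" by simp
    have "\<bar>exp ?x - 1\<bar> \<le> \<bar>?x\<bar> * exp \<bar>?x\<bar>"
    proof (cases "?x \<ge> 0")
      case True
      have "(1 - ?x) * exp ?x \<le> exp (- ?x) * exp ?x"
        using exp_ge_add_one_self[of "- ?x"] by (intro mult_right_mono) auto
      then have "exp ?x - 1 \<le> ?x * exp ?x" by (simp add: mult_exp_exp algebra_simps)
      then show ?thesis using True by simp
    next
      case False
      have "1 - exp ?x \<le> - ?x" using exp_ge_add_one_self[of ?x] by linarith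
      also have "- ?x \<le> \<bar>?x\<bar> * exp \<bar>?x\<bar>"
        using False mult_left_mono[of 1 "exp \<bar>?x\<bar>" "\<bar>?x\<bar>"] by simp
      finally show ?thesis using False by simp
    qed
    also have "\<dots> \<le> (t * \<bar>y\<bar>) * exp \<bar>y\<bar>"
      using xy t by (intro mult_mono) (auto simp: abs_mult)
    finally show ?thesis by (simp add: mult_ac)
  qed
  have bound: "norm (geodesic A B t - A) \<le> C' * t" if t: "0 \<le> t" "t \<le> 1" for t
  proof -
    let ?D = "diag_mat (\<lambda>i. exp (t * h i) - 1) :: real^'n^'n"
    have "norm ?D = L2_set (\<lambda>i. exp (t * h i) - 1) UNIV"
      using norm_conj_diag[OF orthogonal_matrix_id, of "\<lambda>i. exp (t * h i) - 1"]
      by (simp add: conj_diag_def L2_set_def real_sqrt_unique)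
    also have "\<dots> \<le> (\<Sum>i\<in>UNIV. \<bar>exp (t * h i) - 1\<bar>)" by (rule L2_set_le_sum_abs)
    also have "\<dots> \<le> (\<Sum>i\<in>UNIV. t * (\<bar>h i\<bar> * exp \<bar>h i\<bar>))" by (intro sum_mono exp1 t)
    also have "\<dots> = k * t" by (simp add: k_def sum_distrib_left mult.commute)
    finally have D: "norm ?D \<le> k * t" .
    have "geodesic A B t - A = conj_diag G (\<lambda>i. exp (t * h i)) - conj_diag G (\<lambda>i. 1)"
      using A geo by simp
    then have "norm (geodesic A B t - A) = norm (G ** ?D ** transpose G)"
      unfolding conj_diag_diff by (simp add: conj_diag_def)
    also have "\<dots> \<le> (norm G * (k * t) * C) * norm (transpose G) * C"
      using C k t D by (intro order_trans[OF C(2)] mult_right_mono mult_mono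
          order_trans[OF C(2), of G ?D]) auto
    finally show ?thesis by (simp add: C'_def mult_ac)
  qed
  show ?thesis
  proof (rule that[of "C' + 1"])
    show "C' + 1 > 0" using C' by simp
    fix t :: real assume t: "0 \<le> t" "t \<le> 1"
    have "C' * t \<le> (C' + 1) * t" using t by (intro mult_right_mono) auto
    then show "norm (geodesic A B t - A) \<le> (C' + 1) * t" using bound[OF t] by linarith
  qed
qed

text \<open>
  Convexity along the geodesic from \<open>A\<close> to \<open>B\<close> bounds \<open>t * (F B - F A)\<close> below by the increment of \<open>F\<close> up
  to parameter \<open>t\<close>, which is of smaller order than \<open>t\<close> at a critical point.
\<close>

lemma critical_point_imp_global_minimizer:
  fixes A :: "real^'n^'n"
  assumes F: "strictly_g_convex F" and crit: "critical_point F A"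
  shows "global_minimizer F A"
  unfolding global_minimizer_def
proof (intro conjI allI impI)
  show A: "pos_def A" using crit by (simp add: critical_point_def)
  fix B :: "real^'n^'n" assume B: "pos_def B"
  show "F A \<le> F B"
  proof (cases "A = B")
    case False
    obtain C where C: "C > 0" "\<And>t. 0 \<le> t \<Longrightarrow> t \<le> 1 \<Longrightarrow> norm (geodesic A B t - A) \<le> C * t"
      using geodesic_lipschitz_at_0[OF A B] by blast
    have "F A - F B \<le> 0 + \<epsilon>" if "\<epsilon> > 0" for \<epsilon>
    proof -
      define e where "e = \<epsilon> / C"
      have e: "e > 0" using that C by (simp add: e_def)
      have "(F has_derivative (\<lambda>H. 0 \<bullet> H)) (at A within {A. pos_def A})"
        using crit by (simp add: critical_point_def has_gradient_def)
      then obtain d where d: "d > 0" and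
        lin: "\<And>y. pos_def y \<Longrightarrow> norm (y - A) < d \<Longrightarrow> norm (F y - F A - 0 \<bullet> (y - A)) \<le> e * norm (y - A)"
        using e unfolding has_derivative_within_alt by blast
      define t where "t = min (1/2) (d / (2 * C))"
      have t: "0 < t" "t < 1" "C * t < d"
      proof -
        show "0 < t" "t < 1" using d C by (auto simp: t_def)
        have "C * t \<le> C * (d / (2 * C))" using C by (intro mult_left_mono) (auto simp: t_def)
        also have "\<dots> < d" using C d by simp
        finally show "C * t < d" .
      qed
      let ?Y = "geodesic A B t"
      have Y: "norm (?Y - A) \<le> C * t" using C t by simp
      have "F A - F ?Y \<le> e * norm (?Y - A)"
        using lin[OF pos_def_geodesic[OF A B, of t]] Y t by auto
      also have "\<dots> \<le> e * (C * t)" using Y e by (intro mult_left_mono) auto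
      also have "\<dots> = \<epsilon> * t" using C by (simp add: e_def)
      finally have "F A - F ?Y \<le> \<epsilon> * t" .
      moreover have "F ?Y < (1 - t) * F A + t * F B"
        using F A B False t unfolding strictly_g_convex_def by blast
      ultimately have "t * (F A - F B) < t * \<epsilon>" by (simp add: algebra_simps)
      then show ?thesis using t by simp
    qed
    then have "F A - F B \<le> 0" by (rule field_le_epsilon)
    then show ?thesis by simp
  qed simp
qed

theorem mainTheorem6:
  fixes x :: "nat \<Rightarrow> real^'q" and n :: nat and \<eta> :: real
  assumes "n \<ge> 1"
    and "sample_cov n x \<noteq> 0"
    and "\<eta> \<ge> 0"
    and "\<not> invertible (sample_cov n x) \<Longrightarrow> \<eta> > 0"
  shows "strictly_g_convex (L (sample_cov n x) \<eta>)
    \<and> g_coercive (L (sample_cov n x) \<eta>)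
    \<and> (\<exists>\<Sigma>. (\<forall>A. critical_point (L (sample_cov n x) \<eta>) A \<longleftrightarrow> A = \<Sigma>)
         \<and> (\<forall>A. global_minimizer (L (sample_cov n x) \<eta>) A \<longleftrightarrow> A = \<Sigma>))"
proof -
  let ?F = "L (sample_cov n x) \<eta>"
  note S = psd_sample_cov[of n x] assms(2)
  have convex: "strictly_g_convex ?F" by (rule strictly_g_convex_L[OF S assms(3,4)])
  obtain \<kappa> c where \<kappa>: "\<kappa> > 0" "\<And>A. pos_def A \<Longrightarrow> \<kappa> * norm (mat_log A) - c \<le> ?F A"
    using L_coercive[OF S assms(3,4)] by blast
  obtain \<Sigma> where min: "global_minimizer ?F \<Sigma>" using L_minimizer_exists[OF \<kappa>] .
  have unique: "A = \<Sigma>" if "global_minimizer ?F A" for A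
    by (rule global_minimizer_unique[OF convex that min])
  have "critical_point ?F \<Sigma>"
  proof -
    have pd: "pos_def \<Sigma>" using min by (simp add: global_minimizer_def)
    obtain W where W: "has_gradient ?F W \<Sigma>"
      using has_gradient_L[OF pd] S(1) unfolding psd_def by blast
    then show ?thesis
      using global_minimizer_gradient_zero[OF min W] pd by (simp add: critical_point_def)
  qed
  then have "critical_point ?F A \<longleftrightarrow> A = \<Sigma>" for A
    using unique critical_point_imp_global_minimizer[OF convex] by blast
  moreover have "global_minimizer ?F A \<longleftrightarrow> A = \<Sigma>" for A
    using unique min by blast
  ultimately show ?thesis using convex g_coercive_linear_bound[OF \<kappa>] by blast
qed

end
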